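(* Assume $A$ is associative. Let $\Lambda:=\{(x,y)\in M\times M:\|x\|<\|y\|\}$. There exists a family $\{q_{\mathbf{k}}\}_{\mathbf{k}\in\mathbb{N}^m}$, where, for $|\mathbf{k}|=k$, $q_{\mathbf{k}}:M\setminus\{0\}\to M$ is a $(k+1)$-homogeneous polynomial function, such that \[E_m(y-x)=\frac{1}{\sigma_m}\sum_{k\in\mathbb{N}}\ \sum_{|\mathbf{k}|=k}\mathcal{P}_{\mathbf{k}}^{\mathcal{B}}(x)\,\frac{q_{\mathbf{k}}(y)}{\|y\|^{m+2k+1}}\] for all $(x,y)\in\Lambda$. Here the series (indexed by $k$) converges normally in $\Lambda$, because \[\Big\|\sum_{|\mathbf{k}|=k}\mathcal{P}_{\mathbf{k}}^{\mathcal{B}}(x)\,\frac{q_{\mathbf{k}}(y)}{\|y\|^{m+2k+1}}\Big\|\le\sqrt{2}\,\binom{k+m}{m}\,\|x\|^k\,\|y\|^{-m-k}\] for all $k\in\mathbb{N}$ and $(x,y)\in\Lambda$. In particular, $E_m(y-x)$ is a real analytic function in the real variables $x_0,x_1,\ldots,x_m,y_0,y_1,\ldots,y_m$ (for $(x,y)\in\Lambda$).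
   Context: $\mathbb{N}$ includes $0$. $A$ is a finite-dimensional (unital) real $*$-algebra: a finite-dimensional real vector space with an $\mathbb{R}$-bilinear multiplication (here associative) and an involutive real-linear antiautomorphism $x\mapsto x^c$; $\mathbb{R}$ is identified with $\mathbb{R}1$. Set $t(x)=x+x^c$, $n(x)=xx^c$, $\mathbb{S}_A=\{x\in A:t(x)=0,\ n(x)=1\}$, assumed nonempty, and $Q_A=\bigcup_{J\in\mathbb{S}_A}(\mathbb{R}+J\mathbb{R})$. A hypercomplex subspace of $A$ is a real vector subspace $M$ with $\mathbb{R}\subsetneq M\subseteq Q_A$; a hypercomplex basis of $M$ is an ordered real basis $(v_0,\ldots,v_m)$ with $m\ge1$, $v_0=1$, $v_s\in\mathbb{S}_A$ and $v_sv_u=-v_uv_s$ for distinct $s,u\in\{1,\ldots,m\}$. Setting. $M$ is a hypercomplex subspace of $A$ with a fixed hypercomplex basis $\mathcal{B}=(v_0,\ldots,v_m)$, completed to a real basis $\mathcal{B}'=(v_0,\ldots,v_d)$ of $A$; $\|\cdot\|$ is the Euclidean norm on $A$ making $\mathcal{B}'$ orthonormal. Points of $M$ are written $x=\sum_{s=0}^mx_sv_s$, $y=\sum_{s=0}^my_sv_s$. The Cauchy kernel $E_m:M\setminus\{0\}\to A$ is $E_m(x)=\frac{1}{\sigma_m}\frac{x^c}{\|x\|^{m+1}}$, with $\sigma_m=2\,\Gamma(\tfrac12)^{m+1}/\Gamma(\tfrac{m+1}{2})$. For $\mathbf{k}=(k_1,\ldots,k_m)$: $|\mathbf{k}|=\sum_sk_s$;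 $\epsilon_1,\ldots,\epsilon_m$ are the standard unit vectors of $\mathbb{N}^m$. Hypercomplex Fueter variables: $\zeta_s^{\mathcal{B}}=x_s-x_0v_s$, $1\le s\le m$. Hypercomplex Fueter polynomial functions $\mathcal{P}_{\mathbf{k}}^{\mathcal{B}}:M\to A$, $\mathbf{k}\in\mathbb{Z}^m$: $\mathcal{P}_{\mathbf{k}}^{\mathcal{B}}\equiv0$ if $\mathbf{k}\notin\mathbb{N}^m$; $\mathcal{P}_{(0,\ldots,0)}^{\mathcal{B}}\equiv1$; and $|\mathbf{k}|\,\mathcal{P}_{\mathbf{k}}^{\mathcal{B}}(x)=\sum_{s=1}^mk_s\,\mathcal{P}_{\mathbf{k}-\epsilon_s}^{\mathcal{B}}(x)\,\zeta_s^{\mathcal{B}}$ if $\mathbf{k}\in\mathbb{N}^m\setminus\{(0,\ldots,0)\}$. A series $\sum_kf_k$ of continuous functions converges normally in an open set if $\sum_k\max_C\|f_k\|$ converges for every compact subset $C$ of it. *)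

theory Defs
  imports "HOL-Analysis.Analysis"
begin

section \<open>Hypercomplex subspaces of a real star-algebra\<close>

text \<open>
  The algebra is a type of class \<open>real_algebra_1\<close> (associative, unital), and \<open>c\<close> is its
  involution. Its Euclidean norm is that of the class \<open>euclidean_space\<close>, tied to the chosen
  real basis by \<open>orthonormal_family\<close> below.
\<close>

definition star_involution :: "('a::real_algebra_1 \<Rightarrow> 'a) \<Rightarrow> bool" where
  "star_involution c \<longleftrightarrow>
     linear c \<and> (\<forall>x. c (c x) = x) \<and> (\<forall>x y. c (x * y) = c y * c x)"

definition star_trace :: "('a::real_algebra_1 \<Rightarrow> 'a) \<Rightarrow> 'a \<Rightarrow> 'a" where
  "star_trace c x = x + c x"

definition star_norm :: "('a::real_algebra_1 \<Rightarrow> 'a) \<Rightarrow> 'a \<Rightarrow> 'a" where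
  "star_norm c x = x * c x"

definition imaginary_units :: "('a::real_algebra_1 \<Rightarrow> 'a) \<Rightarrow> 'a set" where
  "imaginary_units c = {x. star_trace c x = 0 \<and> star_norm c x = 1}"

definition quadratic_cone :: "('a::real_algebra_1 \<Rightarrow> 'a) \<Rightarrow> 'a set" where
  "quadratic_cone c = (\<Union>J\<in>imaginary_units c. {of_real a + J * of_real b | a b. True})"

definition hypercomplex_subspace :: "('a::real_algebra_1 \<Rightarrow> 'a) \<Rightarrow> 'a set \<Rightarrow> bool" where
  "hypercomplex_subspace c M \<longleftrightarrow>
     subspace M \<and> range of_real \<subset> M \<and> M \<subseteq> quadratic_cone c"

definition ordered_basis :: "(nat \<Rightarrow> 'a::real_vector) \<Rightarrow> nat \<Rightarrow> 'a set \<Rightarrow> bool" where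
  "ordered_basis v n V \<longleftrightarrow>
     inj_on v {..n} \<and> independent (v ` {..n}) \<and> span (v ` {..n}) = V"

definition hypercomplex_basis ::
    "('a::real_algebra_1 \<Rightarrow> 'a) \<Rightarrow> 'a set \<Rightarrow> nat \<Rightarrow> (nat \<Rightarrow> 'a) \<Rightarrow> bool" where
  "hypercomplex_basis c M m v \<longleftrightarrow>
     ordered_basis v m M \<and> 1 \<le> m \<and> v 0 = 1 \<and>
     (\<forall>s\<in>{1..m}. v s \<in> imaginary_units c) \<and>
     (\<forall>s\<in>{1..m}. \<forall>u\<in>{1..m}. s \<noteq> u \<longrightarrow> v s * v u = - (v u * v s))"

definition orthonormal_family :: "(nat \<Rightarrow> 'a::real_inner) \<Rightarrow> nat \<Rightarrow> bool" where
  "orthonormal_family v n \<longleftrightarrow>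
     (\<forall>i\<le>n. \<forall>j\<le>n. v i \<bullet> v j = (if i = j then 1 else 0))"

section \<open>Cauchy kernel\<close>

definition sphere_const :: "nat \<Rightarrow> real" where
  "sphere_const m = 2 * Gamma (1/2) ^ (m + 1) / Gamma ((real m + 1) / 2)"

definition cauchy_kernel ::
    "('a::{euclidean_space, real_algebra_1} \<Rightarrow> 'a) \<Rightarrow> nat \<Rightarrow> 'a \<Rightarrow> 'a" where
  "cauchy_kernel c m x = (1 / sphere_const m) *\<^sub>R ((1 / norm x ^ (m + 1)) *\<^sub>R c x)"

section \<open>Multi-indices and polynomial functions\<close>

text \<open>
  Multi-indices with index set \<open>I\<close> are functions that vanish off \<open>I\<close>, so that each
  multi-index has exactly one representative.
\<close>

definition multi_indices :: "'i set \<Rightarrow> ('i \<Rightarrow> nat) set" where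
  "multi_indices I = {\<alpha>. \<forall>i. i \<notin> I \<longrightarrow> \<alpha> i = 0}"

definition multi_indices_deg :: "'i set \<Rightarrow> nat \<Rightarrow> ('i \<Rightarrow> nat) set" where
  "multi_indices_deg I n = {\<alpha> \<in> multi_indices I. (\<Sum>i\<in>I. \<alpha> i) = n}"

lemma finite_multi_indices_deg:
  assumes "finite I"
  shows "finite (multi_indices_deg I n)"
proof (rule finite_subset)
  show "multi_indices_deg I n \<subseteq>
      {f. \<forall>x. (x \<in> I \<longrightarrow> f x \<in> {..n}) \<and> (x \<notin> I \<longrightarrow> f x = 0)}"
    using assms by (auto simp: multi_indices_deg_def multi_indices_def intro: member_le_sum)
  show "finite {f. \<forall>x. (x \<in> I \<longrightarrow> f x \<in> {..n}) \<and> (x \<notin> I \<longrightarrow> f x = 0)}"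
    using assms by (intro finite_set_of_finite_funs) auto
qed

text \<open>
  The real coordinates of \<open>y\<close> in the span of the orthonormal family \<open>v\<close> are
  the inner products \<open>y \<bullet> v s\<close>.
\<close>

definition homogeneous_polynomial_on ::
    "(nat \<Rightarrow> 'a::real_inner) \<Rightarrow> nat \<Rightarrow> nat \<Rightarrow> 'a set \<Rightarrow> ('a \<Rightarrow> 'b::real_vector) \<Rightarrow> bool" where
  "homogeneous_polynomial_on v m n U q \<longleftrightarrow>
     (\<exists>a. \<forall>y\<in>U. q y =
        (\<Sum>\<alpha>\<in>multi_indices_deg {..m} n. (\<Prod>s\<le>m. (y \<bullet> v s) ^ \<alpha> s) *\<^sub>R a \<alpha>))"

section \<open>Hypercomplex Fueter polynomial functions\<close>

definition fueter_var :: "(nat \<Rightarrow> 'a::{real_inner, real_algebra_1}) \<Rightarrow> nat \<Rightarrow> 'a \<Rightarrow> 'a" where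
  "fueter_var v s x = of_real (x \<bullet> v s) - (x \<bullet> v 0) *\<^sub>R v s"

text \<open>Only the entries of \<open>k\<close> at \<open>1, \<dots>, m\<close> matter.\<close>

function fueter_poly ::
    "(nat \<Rightarrow> 'a::{real_inner, real_algebra_1}) \<Rightarrow> nat \<Rightarrow> (nat \<Rightarrow> int) \<Rightarrow> 'a \<Rightarrow> 'a" where
  "fueter_poly v m k x =
     (if \<exists>s\<in>{1..m}. k s < 0 then 0
      else if \<forall>s\<in>{1..m}. k s = 0 then 1
      else (1 / of_int (\<Sum>s=1..m. k s)) *\<^sub>R
             (\<Sum>s=1..m. of_int (k s) *\<^sub>R (fueter_poly v m (k(s := k s - 1)) x * fueter_var v s x)))"
  by pat_completeness auto

termination
proof (relation "Wellfounded.measure (\<lambda>(v, m, k, x). nat (\<Sum>s=1..m. k s))", goal_cases)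
  case 1
  show ?case by simp
next
  case (2 v m k x s)
  have nonneg: "\<forall>u\<in>{1..m}. 0 \<le> k u" and "\<not> (\<forall>u\<in>{1..m}. k u = 0)"
    using 2 by (auto simp: not_less)
  then have "0 < (\<Sum>u=1..m. k u)"
    by (metis finite_atLeastAtMost order_le_less sum_nonneg sum_nonneg_eq_0_iff)
  moreover have "(\<Sum>u=1..m. (k(s := k s - 1)) u) = (\<Sum>u=1..m. k u) - 1"
    using 2 by (simp add: sum.remove[of _ s])
  ultimately show ?case by simp
qed

declare fueter_poly.simps [simp del]

section \<open>The series, its convergence, and real analyticity\<close>

definition kernel_domain :: "'a::real_normed_vector set \<Rightarrow> ('a \<times> 'a) set" where
  "kernel_domain M = {(x, y). x \<in> M \<and> y \<in> M \<and> norm x < norm y}"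

definition kernel_term ::
    "(nat \<Rightarrow> 'a::{real_inner, real_algebra_1}) \<Rightarrow> nat \<Rightarrow> ((nat \<Rightarrow> nat) \<Rightarrow> 'a \<Rightarrow> 'a) \<Rightarrow>
      nat \<Rightarrow> 'a \<times> 'a \<Rightarrow> 'a" where
  "kernel_term v m q n = (\<lambda>(x, y).
     \<Sum>k\<in>multi_indices_deg {1..m} n.
       fueter_poly v m (\<lambda>s. int (k s)) x * ((1 / norm y ^ (m + 2 * n + 1)) *\<^sub>R q k y))"

text \<open>
  \<open>C = {}\<close> is excluded because \<open>Sup {}\<close> is unspecified on the reals; on a nonempty compact
  set the supremum of a continuous function is its maximum.
\<close>

definition normally_convergent_on ::
    "'z::topological_space set \<Rightarrow> (nat \<Rightarrow> 'z \<Rightarrow> 'b::real_normed_vector) \<Rightarrow> bool" where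
  "normally_convergent_on U f \<longleftrightarrow>
     (\<forall>n. continuous_on U (f n)) \<and>
     (\<forall>C. compact C \<and> C \<noteq> {} \<and> C \<subseteq> U \<longrightarrow> summable (\<lambda>n. SUP z\<in>C. norm (f n z)))"

text \<open>
  Real analyticity of \<open>f\<close> on \<open>U\<close> in the real variables \<open>X i\<close>, \<open>i \<in> I\<close>: near each point of
  \<open>U\<close>, \<open>f\<close> is the sum of an unconditionally convergent power series in these variables.
  It is meant for \<open>U\<close> whose image under the coordinates \<open>X\<close> is open.
\<close>

definition real_analytic_in_on ::
    "'i set \<Rightarrow> ('i \<Rightarrow> 'z \<Rightarrow> real) \<Rightarrow> 'z set \<Rightarrow> ('z \<Rightarrow> 'b::real_normed_vector) \<Rightarrow> bool" where
  "real_analytic_in_on I X U f \<longleftrightarrow>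
     (\<forall>p\<in>U. \<exists>r>0. \<exists>a. \<forall>z\<in>U. (\<forall>i\<in>I. \<bar>X i z - X i p\<bar> < r) \<longrightarrow>
        ((\<lambda>\<alpha>. (\<Prod>i\<in>I. (X i z - X i p) ^ \<alpha> i) *\<^sub>R a \<alpha>) has_sum f z) (multi_indices I))"

text \<open>The variables \<open>x\<^sub>s\<close> (\<open>Inl s\<close>) and \<open>y\<^sub>s\<close> (\<open>Inr s\<close>) of a pair \<open>(x, y)\<close>.\<close>

definition pair_coord :: "(nat \<Rightarrow> 'a::real_inner) \<Rightarrow> nat + nat \<Rightarrow> 'a \<times> 'a \<Rightarrow> real" where
  "pair_coord v i z = (case i of Inl s \<Rightarrow> fst z \<bullet> v s | Inr s \<Rightarrow> snd z \<bullet> v s)"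

end

theory Submission
  imports Defs "HOL-Library.Multiset"
begin

text \<open>
  Up to the factor \<open>1 / \<sigma>\<^sub>m\<close>, the Cauchy kernel is \<open>E w = c w / \<bar>w\<bar>\<^sup>m\<^sup>+\<^sup>1\<close>. The expansion is
  its Taylor expansion at \<open>y\<close>, rewritten with the help of the Dirac equation.

  Each partial derivative of \<open>E\<close>, of order \<open>n\<close>, is \<open>p / \<bar>w\<bar>\<^sup>m\<^sup>+\<^sup>2\<^sup>n\<^sup>+\<^sup>1\<close> with \<open>p\<close> a homogeneous
  polynomial of degree \<open>n + 1\<close> and values in \<open>M\<close>; these numerators, scaled by \<open>(-1)\<^sup>n / k!\<close>, are the
  functions \<open>q\<close>. The numerators are built by formal operators on coefficient functions, so that the
  symmetry of iterated derivatives is an algebraic commutation relation (\<open>raise_raise\<close>).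

  The degree-\<open>n\<close> Taylor term is an \<open>n\<close>-fold sum over directions \<open>s = 0, \<dots>, m\<close> of products of
  coordinates \<open>x\<^sub>s\<close> with derivatives of \<open>E\<close>. The kernel and all its derivatives are killed by the Dirac
  operator \<open>\<Sum>\<^sub>s v\<^sub>s \<partial>\<^sub>s\<close> (\<open>dirac_kernel_diff\<close>). Solving for \<open>\<partial>\<^sub>0\<close> turns
  \<open>\<Sum>\<^sub>s\<^sub>\<ge>\<^sub>0 x\<^sub>s \<partial>\<^sub>s\<close> into \<open>\<Sum>\<^sub>s\<^sub>\<ge>\<^sub>1 \<zeta>\<^sub>s \<partial>\<^sub>s\<close> with the Fueter variables \<open>\<zeta>\<^sub>s\<close>; doing so in every factor leaves
  sums of words in the \<open>\<zeta>\<^sub>s\<close>, and collecting the words with the same content gives the Fueter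
  polynomials, because these obey the recursion satisfied by such sums (\<open>word_sum_expand\<close>).

  Convergence and the norm bound come from a complex variable. In the plane spanned by \<open>x\<close> and
  \<open>y\<close> one has \<open>\<bar>y + x\<bar> = \<bar>y\<bar> \<bar>1 - z\<bar>\<close> for a complex \<open>z\<close> of modulus \<open>\<bar>x\<bar> / \<bar>y\<bar>\<close>, and
  \<open>\<bar>1 - z\<bar>\<^sup>-\<^sup>(\<^sup>m\<^sup>+\<^sup>1\<^sup>)\<close> is the Cauchy product of two conjugate binomial series. The resulting series
  of \<open>E\<close> has terms whose coefficients in \<open>z\<close> and its conjugate are nonnegative, so that a term of
  degree \<open>n\<close> is bounded by \<open>\<bar>z\<bar>\<^sup>n\<close> times the sum of its coefficients; Vandermonde's identity bounds
  that sum by \<open>n + m choose m\<close>. Uniqueness of one-variable power series identifies these terms with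
  the Taylor terms (\<open>kernel_taylor\<close>).

  The same Taylor expansion gives real analyticity: the derivatives of order \<open>n\<close> at a point grow at
  most like \<open>C\<^sup>n n!\<close>, so that expanding the coordinates of \<open>y - x\<close> into those of \<open>x\<close> and \<open>y\<close> leaves
  an absolutely convergent power series (\<open>has_sum_multi_indices\<close>).
\<close>

section \<open>Multi-indices and iterated sums\<close>

lemma multi_indices_deg_0:
  assumes "finite I"
  shows "multi_indices_deg I 0 = {\<lambda>_. 0}"
  using assms by (fastforce simp: multi_indices_deg_def multi_indices_def)

lemma multi_indices_deg_fun_upd_Suc:
  assumes "finite I" "s \<in> I" "k \<in> multi_indices_deg I n"
  shows "k(s := Suc (k s)) \<in> multi_indices_deg I (Suc n)"
  using assms by (auto simp: multi_indices_deg_def multi_indices_def sum.remove[of I s])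

lemma multi_indices_deg_fun_upd_pred:
  assumes "finite I" "s \<in> I" "k \<in> multi_indices_deg I (Suc n)" "k s \<noteq> 0"
  shows "k(s := k s - 1) \<in> multi_indices_deg I n"
  using assms by (auto simp: multi_indices_deg_def multi_indices_def sum.remove[of I s])

text \<open>
  Every product rule below shifts one exponent; this is the corresponding change of the
  summation index.
\<close>

lemma sum_multi_indices_deg_Suc:
  fixes g :: "('i \<Rightarrow> nat) \<Rightarrow> 'b::comm_monoid_add"
  assumes "finite I" "s \<in> I"
  shows "(\<Sum>k\<in>multi_indices_deg I (Suc n). if k s = 0 then 0 else g k) =
    (\<Sum>k\<in>multi_indices_deg I n. g (k(s := Suc (k s))))"
proof -
  have "(\<Sum>k\<in>multi_indices_deg I (Suc n). if k s = 0 then 0 else g k) =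
      (\<Sum>k\<in>{k \<in> multi_indices_deg I (Suc n). k s \<noteq> 0}. g k)"
    by (intro sum.mono_neutral_cong_right finite_multi_indices_deg assms) auto
  also have "\<dots> = (\<Sum>k\<in>multi_indices_deg I n. g (k(s := Suc (k s))))"
    by (rule sum.reindex_bij_witness
        [of _ "\<lambda>k. k(s := Suc (k s))" "\<lambda>k. k(s := k s - 1)"])
      (auto simp: multi_indices_deg_fun_upd_Suc[OF assms]
        intro: multi_indices_deg_fun_upd_pred[OF assms, simplified])
  finally show ?thesis .
qed

definition multi_fact :: "'i set \<Rightarrow> ('i \<Rightarrow> nat) \<Rightarrow> real" where
  "multi_fact I k = (\<Prod>i\<in>I. fact (k i))"

lemma multi_fact_pos: "0 < multi_fact I k"
  by (simp add: multi_fact_def prod_pos)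

lemma multi_fact_Suc:
  assumes "finite I" "s \<in> I"
  shows "multi_fact I (k(s := Suc (k s))) = real (Suc (k s)) * multi_fact I k"
proof -
  have "(\<Prod>i\<in>I - {s}. fact ((k(s := Suc (k s))) i)) = (\<Prod>i\<in>I - {s}. fact (k i) :: real)"
    by (intro prod.cong) auto
  then show ?thesis
    using assms by (simp add: multi_fact_def prod.remove[of I s])
qed

lemma finite_support_multi_indices_deg:
  assumes "finite I" "k \<in> multi_indices_deg I n"
  shows "finite {i. 0 < k i}"
  by (rule finite_subset[OF _ assms(1)])
    (use assms(2) in \<open>auto simp: multi_indices_deg_def multi_indices_def\<close>)

lemma Abs_multiset_Suc:
  assumes "finite {i. 0 < k i}"
  shows "Abs_multiset (k(s := Suc (k s))) = add_mset s (Abs_multiset k)"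
proof -
  have "finite {i. 0 < (k(s := Suc (k s))) i}"
    by (rule finite_subset[of _ "insert s {i. 0 < k i}"]) (use assms in auto)
  then show ?thesis
    using assms by (intro multiset_eqI) (simp add: count_Abs_multiset)
qed

lemma Abs_multiset_deg:
  assumes "finite I" "k \<in> multi_indices_deg I n"
  shows "set_mset (Abs_multiset k) \<subseteq> I" "size (Abs_multiset k) = n"
proof -
  note fin = finite_support_multi_indices_deg[OF assms]
  have *: "set_mset (Abs_multiset k) = {i. 0 < k i}"
    by (simp add: set_mset_def count_Abs_multiset[OF fin])
  show sub: "set_mset (Abs_multiset k) \<subseteq> I"
    unfolding * using assms(2) by (auto simp: multi_indices_deg_def multi_indices_def)
  have "size (Abs_multiset k) = (\<Sum>i\<in>set_mset (Abs_multiset k). k i)"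
    by (simp add: size_multiset_overloaded_eq count_Abs_multiset[OF fin])
  also have "\<dots> = (\<Sum>i\<in>I. k i)"
    by (intro sum.mono_neutral_left assms sub) (auto simp: *)
  finally show "size (Abs_multiset k) = n"
    using assms(2) by (simp add: multi_indices_deg_def)
qed

text \<open>
  If \<open>G B\<close> is the iterated partial derivative of a function in the directions collected in the
  multiset \<open>B\<close>, then \<open>word_sum I z G n {#}\<close> is its \<open>n\<close>-th derivative in the direction with
  coordinates \<open>z\<close>. The factors \<open>z i\<close> may be noncommuting algebra elements: they are multiplied in
  the order of the directions.
\<close>

primrec word_sum :: "'i set \<Rightarrow> ('i \<Rightarrow> 'a::real_algebra_1) \<Rightarrow> ('i multiset \<Rightarrow> 'a) \<Rightarrow>
    nat \<Rightarrow> 'i multiset \<Rightarrow> 'a" where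
  "word_sum I z G 0 B = G B"
| "word_sum I z G (Suc n) B = (\<Sum>i\<in>I. z i * word_sum I z G n (add_mset i B))"

text \<open>
  The words in the \<open>z s\<close> with content \<open>k\<close> add up to \<open>fact n / multi_fact I k\<close> times \<open>Q k\<close>: a word of
  content \<open>k\<close> arises from one of content \<open>k - \<epsilon>\<^sub>s\<close> by appending the letter \<open>z s\<close>, which is the
  recursion assumed for \<open>Q\<close>. The free parameter \<open>j\<close>, the number of factors that are not yet
  expanded, makes the induction work. Both monomials and Fueter polynomials are instances of \<open>Q\<close>.
\<close>

lemma word_sum_expand:
  fixes Q :: "('i \<Rightarrow> nat) \<Rightarrow> 'a::real_algebra_1"
  assumes I: "finite I"
    and Q0: "Q (\<lambda>_. 0) = 1"
    and QS: "\<And>n k. k \<in> multi_indices_deg I (Suc n) \<Longrightarrow> real (Suc n) *\<^sub>R Q k =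
        (\<Sum>s\<in>I. if k s = 0 then 0 else real (k s) *\<^sub>R (Q (k(s := k s - 1)) * z s))"
  shows "word_sum I z G (j + n) {#} =
    (\<Sum>k\<in>multi_indices_deg I n.
      (fact n / multi_fact I k) *\<^sub>R (Q k * word_sum I z G j (Abs_multiset k)))"
proof (induction n arbitrary: j)
  case 0
  have "Abs_multiset (\<lambda>_::'i. 0) = {#}"
    by (intro multiset_eqI) (simp add: count_Abs_multiset)
  then show ?case
    by (simp add: multi_indices_deg_0[OF I] Q0 multi_fact_def)
next
  case (Suc n)
  let ?W = "\<lambda>k. word_sum I z G j (Abs_multiset k)"
  let ?g = "\<lambda>s k. (fact n * real (k s) / multi_fact I k) *\<^sub>R (Q (k(s := k s - 1)) * z s * ?W k)"
  have "word_sum I z G (j + Suc n) {#} =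
      (\<Sum>k\<in>multi_indices_deg I n. (fact n / multi_fact I k) *\<^sub>R
        (Q k * word_sum I z G (Suc j) (Abs_multiset k)))"
    using Suc.IH[of "Suc j"] by simp
  also have "\<dots> = (\<Sum>k\<in>multi_indices_deg I n. \<Sum>s\<in>I. ?g s (k(s := Suc (k s))))"
  proof (rule sum.cong[OF refl])
    fix k assume k: "k \<in> multi_indices_deg I n"
    note fin = finite_support_multi_indices_deg[OF I k]
    have "?g s (k(s := Suc (k s))) = (fact n / multi_fact I k) *\<^sub>R
        (Q k * (z s * word_sum I z G j (add_mset s (Abs_multiset k))))" if "s \<in> I" for s
      using that by (simp add: multi_fact_Suc[OF I] Abs_multiset_Suc[OF fin] mult.assoc
          del: of_nat_Suc)
    then show "(fact n / multi_fact I k) *\<^sub>R (Q k * word_sum I z G (Suc j) (Abs_multiset k)) =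
        (\<Sum>s\<in>I. ?g s (k(s := Suc (k s))))"
      by (simp add: sum_distrib_left scaleR_sum_right)
  qed
  also have "\<dots> = (\<Sum>s\<in>I. \<Sum>k\<in>multi_indices_deg I n. ?g s (k(s := Suc (k s))))"
    by (rule sum.swap)
  also have "\<dots> = (\<Sum>s\<in>I. \<Sum>k\<in>multi_indices_deg I (Suc n). if k s = 0 then 0 else ?g s k)"
    by (rule sum.cong[OF refl], rule sum_multi_indices_deg_Suc[OF I, symmetric])
  also have "\<dots> = (\<Sum>k\<in>multi_indices_deg I (Suc n). \<Sum>s\<in>I. if k s = 0 then 0 else ?g s k)"
    by (rule sum.swap)
  also have "\<dots> = (\<Sum>k\<in>multi_indices_deg I (Suc n).
      (fact (Suc n) / multi_fact I k) *\<^sub>R (Q k * ?W k))"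
  proof (rule sum.cong[OF refl])
    fix k assume k: "k \<in> multi_indices_deg I (Suc n)"
    have "(\<Sum>s\<in>I. if k s = 0 then 0 else ?g s k) = (fact n / multi_fact I k) *\<^sub>R
       ((\<Sum>s\<in>I. if k s = 0 then 0 else real (k s) *\<^sub>R (Q (k(s := k s - 1)) * z s)) * ?W k)"
      by (simp add: sum_distrib_right scaleR_sum_right if_distrib[of "\<lambda>x. x * _"]
          if_distrib[of "\<lambda>x. _ *\<^sub>R x"] cong: if_cong)
    also have "\<dots> = (fact n / multi_fact I k) *\<^sub>R ((real (Suc n) *\<^sub>R Q k) * ?W k)"
      by (simp only: QS[OF k])
    also have "\<dots> = (fact (Suc n) / multi_fact I k) *\<^sub>R (Q k * ?W k)"
      by (simp add: mult.commute del: of_nat_Suc)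
    finally show "(\<Sum>s\<in>I. if k s = 0 then 0 else ?g s k) =
        (fact (Suc n) / multi_fact I k) *\<^sub>R (Q k * ?W k)" .
  qed
  finally show ?case .
qed

section \<open>Formal polynomials\<close>

text \<open>
  A polynomial in the coordinates \<open>w\<^sub>0, w\<^sub>1, \<dots>\<close> is represented by its coefficient function. The
  operations below are the formal counterparts of constants (\<open>fconst\<close>), multiplication by
  \<open>w\<^sub>s\<close> (\<open>fmul\<close>), \<open>\<partial>\<^sub>s\<close> (\<open>fdiff\<close>) and multiplication by \<open>w\<^sub>0\<^sup>2 + \<dots> + w\<^sub>m\<^sup>2\<close> (\<open>fnorm2\<close>). They are defined on
  arbitrary coefficient functions; a degree is chosen only upon evaluation.
\<close>

type_synonym 'a coeffs = "(nat \<Rightarrow> nat) \<Rightarrow> 'a"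

definition fconst :: "'a \<Rightarrow> 'a::zero coeffs" where
  "fconst a \<alpha> = (if \<alpha> = (\<lambda>_. 0) then a else 0)"

definition fmul :: "nat \<Rightarrow> 'a::zero coeffs \<Rightarrow> 'a coeffs" where
  "fmul s p \<alpha> = (if \<alpha> s = 0 then 0 else p (\<alpha>(s := \<alpha> s - 1)))"

definition fdiff :: "nat \<Rightarrow> 'a::real_vector coeffs \<Rightarrow> 'a coeffs" where
  "fdiff s p \<alpha> = real (Suc (\<alpha> s)) *\<^sub>R p (\<alpha>(s := Suc (\<alpha> s)))"

definition fnorm2 :: "nat \<Rightarrow> 'a::real_vector coeffs \<Rightarrow> 'a coeffs" where
  "fnorm2 m p \<alpha> = (\<Sum>u\<le>m. fmul u (fmul u p) \<alpha>)"

text \<open>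
  The numerator of \<open>\<partial>\<^sub>s (p / \<bar>w\<bar>\<^sup>\<kappa>) = (\<bar>w\<bar>\<^sup>2 \<partial>\<^sub>s p - \<kappa> w\<^sub>s p) / \<bar>w\<bar>\<^sup>\<kappa>\<^sup>+\<^sup>2\<close>.
\<close>

definition raise :: "nat \<Rightarrow> nat \<Rightarrow> real \<Rightarrow> 'a::real_vector coeffs \<Rightarrow> 'a coeffs" where
  "raise m s \<kappa> p \<alpha> = fnorm2 m (fdiff s p) \<alpha> - \<kappa> *\<^sub>R fmul s p \<alpha>"

lemma fmul_fmul: "fmul s (fmul u p) = fmul u (fmul s p)"
  by (cases "s = u") (auto simp: fmul_def fun_eq_iff fun_upd_twist)

lemma fdiff_fdiff: "fdiff s (fdiff u p) = fdiff u (fdiff s p)"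
  by (cases "s = u") (auto simp: fdiff_def fun_eq_iff fun_upd_twist mult.commute)

lemma fdiff_fmul: "fdiff s (fmul u p) \<alpha> = fmul u (fdiff s p) \<alpha> + (if s = u then p \<alpha> else 0)"
proof (cases "s = u")
  case True
  then show ?thesis
    by (cases "\<alpha> u") (auto simp: fdiff_def fmul_def fun_upd_idem scaleR_left_distrib scaleR_2)
next
  case False
  then show ?thesis
    by (auto simp: fdiff_def fmul_def fun_upd_twist)
qed

lemma fdiff_fconst: "fdiff s (fconst a) \<alpha> = 0"
  by (auto simp: fdiff_def fconst_def fun_eq_iff intro: exI[of _ s])

lemma fmul_lin:
  "fmul s (\<lambda>\<alpha>. p \<alpha> + q \<alpha>) \<alpha> = fmul s p \<alpha> + fmul s (q :: 'a::real_vector coeffs) \<alpha>"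
  "fmul s (\<lambda>\<alpha>. p \<alpha> - q \<alpha>) \<alpha> = fmul s p \<alpha> - fmul s q \<alpha>"
  "fmul s (\<lambda>\<alpha>. r *\<^sub>R p \<alpha>) \<alpha> = r *\<^sub>R fmul s p \<alpha>"
  "fmul s (\<lambda>\<alpha>. \<Sum>i\<in>A. P i \<alpha>) \<alpha> = (\<Sum>i\<in>A. fmul s (P i :: 'a coeffs) \<alpha>)"
  by (auto simp: fmul_def)

lemma fdiff_lin:
  "fdiff s (\<lambda>\<alpha>. p \<alpha> - q \<alpha>) \<alpha> = fdiff s p \<alpha> - fdiff s (q :: 'a::real_vector coeffs) \<alpha>"
  "fdiff s (\<lambda>\<alpha>. r *\<^sub>R p \<alpha>) \<alpha> = r *\<^sub>R fdiff s p \<alpha>"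
  "fdiff s (\<lambda>\<alpha>. \<Sum>i\<in>A. P i \<alpha>) \<alpha> = (\<Sum>i\<in>A. fdiff s (P i :: 'a coeffs) \<alpha>)"
  by (auto simp: fdiff_def scaleR_right_diff_distrib scaleR_sum_right mult.commute)

lemma fnorm2_lin:
  "fnorm2 m (\<lambda>\<alpha>. p \<alpha> + q \<alpha>) \<alpha> = fnorm2 m p \<alpha> + fnorm2 m (q :: 'a::real_vector coeffs) \<alpha>"
  "fnorm2 m (\<lambda>\<alpha>. p \<alpha> - q \<alpha>) \<alpha> = fnorm2 m p \<alpha> - fnorm2 m q \<alpha>"
  "fnorm2 m (\<lambda>\<alpha>. r *\<^sub>R p \<alpha>) \<alpha> = r *\<^sub>R fnorm2 m p \<alpha>"
  "fnorm2 m (\<lambda>\<alpha>. \<Sum>i\<in>A. P i \<alpha>) \<alpha> = (\<Sum>i\<in>A. fnorm2 m (P i :: 'a coeffs) \<alpha>)"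
proof -
  have *: "fnorm2 m f = (\<lambda>\<alpha>. \<Sum>u\<le>m. fmul u (fmul u f) \<alpha>)" for f :: "'a coeffs"
    by (simp add: fun_eq_iff fnorm2_def)
  have e: "fmul u (\<lambda>\<alpha>. p \<alpha> + q \<alpha>) = (\<lambda>\<alpha>. fmul u p \<alpha> + fmul u q \<alpha>)"
    "fmul u (\<lambda>\<alpha>. p \<alpha> - q \<alpha>) = (\<lambda>\<alpha>. fmul u p \<alpha> - fmul u q \<alpha>)"
    "fmul u (\<lambda>\<alpha>. r *\<^sub>R p \<alpha>) = (\<lambda>\<alpha>. r *\<^sub>R fmul u p \<alpha>)"
    "fmul u (\<lambda>\<alpha>. \<Sum>i\<in>A. P i \<alpha>) = (\<lambda>\<alpha>. \<Sum>i\<in>A. fmul u (P i) \<alpha>)" for u r and p q :: "'a coeffs" and A and P :: "_ \<Rightarrow> 'a coeffs"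
    by (simp_all add: fun_eq_iff fmul_lin)
  show "fnorm2 m (\<lambda>\<alpha>. p \<alpha> + q \<alpha>) \<alpha> = fnorm2 m p \<alpha> + fnorm2 m q \<alpha>"
    "fnorm2 m (\<lambda>\<alpha>. p \<alpha> - q \<alpha>) \<alpha> = fnorm2 m p \<alpha> - fnorm2 m q \<alpha>"
    "fnorm2 m (\<lambda>\<alpha>. r *\<^sub>R p \<alpha>) \<alpha> = r *\<^sub>R fnorm2 m p \<alpha>"
    unfolding * e by (simp_all add: sum.distrib sum_subtractf scaleR_sum_right)
  show "fnorm2 m (\<lambda>\<alpha>. \<Sum>i\<in>A. P i \<alpha>) \<alpha> = (\<Sum>i\<in>A. fnorm2 m (P i) \<alpha>)"
    unfolding * e by (rule sum.swap)
qed

lemma fmul_fnorm2: "fmul s (fnorm2 m p) = fnorm2 m (fmul s p)"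
proof -
  have "fmul s (fnorm2 m p) \<alpha> = fnorm2 m (fmul s p) \<alpha>" for \<alpha>
    unfolding fnorm2_def[abs_def] fmul_lin fmul_fmul[of s] ..
  then show ?thesis ..
qed

lemma fdiff_fnorm2:
  assumes "s \<le> m"
  shows "fdiff s (fnorm2 m p) = (\<lambda>\<alpha>. fnorm2 m (fdiff s p) \<alpha> + 2 *\<^sub>R fmul s p \<alpha>)"
proof
  fix \<alpha>
  have e: "fdiff s (fmul u p) = (\<lambda>\<alpha>. fmul u (fdiff s p) \<alpha> + (if s = u then p \<alpha> else 0))" for s u
    by (simp add: fun_eq_iff fdiff_fmul)
  have "fdiff s (fmul u (fmul u p)) \<alpha> =
      fmul u (fmul u (fdiff s p)) \<alpha> + (if s = u then 2 *\<^sub>R fmul s p \<alpha> else 0)" for u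
    by (cases "s = u") (simp_all add: fdiff_fmul e fmul_lin scaleR_2)
  then show "fdiff s (fnorm2 m p) \<alpha> = fnorm2 m (fdiff s p) \<alpha> + 2 *\<^sub>R fmul s p \<alpha>"
    using assms unfolding fnorm2_def[abs_def] fdiff_lin by (simp add: sum.distrib)
qed

lemma raise_eq: "raise m s \<kappa> p = (\<lambda>\<alpha>. fnorm2 m (fdiff s p) \<alpha> - \<kappa> *\<^sub>R fmul s p \<alpha>)"
  by (simp add: fun_eq_iff raise_def)

lemma raise_lin:
  "raise m s \<kappa> (\<lambda>\<alpha>. \<Sum>i\<in>A. P i \<alpha>) \<alpha> = (\<Sum>i\<in>A. raise m s \<kappa> (P i :: 'a::real_vector coeffs) \<alpha>)"
proof -
  have e: "fdiff s (\<lambda>\<alpha>. \<Sum>i\<in>A. P i \<alpha>) = (\<lambda>\<alpha>. \<Sum>i\<in>A. fdiff s (P i) \<alpha>)"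
    by (simp add: fun_eq_iff fdiff_lin)
  show ?thesis
    unfolding raise_def e fmul_lin fnorm2_lin scaleR_sum_right sum_subtractf ..
qed

lemma raise_mult_left:
  "raise m s \<kappa> (\<lambda>\<alpha>. a * p \<alpha>) \<alpha> = a * raise m s \<kappa> (p :: 'a::real_algebra_1 coeffs) \<alpha>"
  by (auto simp: raise_def fnorm2_def fmul_def fdiff_def right_diff_distrib sum_distrib_left
      intro!: sum.cong)

text \<open>
  Partial derivatives of \<open>p / \<bar>w\<bar>\<^sup>\<kappa>\<close> commute. Expanded with the relations \<open>\<partial>\<^sub>s w\<^sub>u = w\<^sub>u \<partial>\<^sub>s + \<delta>\<^sub>s\<^sub>u\<close> and
  \<open>\<partial>\<^sub>s \<bar>w\<bar>\<^sup>2 = \<bar>w\<bar>\<^sup>2 \<partial>\<^sub>s + 2 w\<^sub>s\<close>, the composition becomes symmetric in \<open>s\<close> and \<open>u\<close>; the exponent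
  \<open>\<kappa> + 2\<close> of the outer step makes the mixed terms \<open>w\<^sub>s \<partial>\<^sub>u\<close> and \<open>w\<^sub>u \<partial>\<^sub>s\<close> occur with equal weights.
\<close>

lemma raise_raise:
  assumes "s \<le> m" "u \<le> m"
  shows "raise m s (\<kappa> + 2) (raise m u \<kappa> p) = raise m u (\<kappa> + 2) (raise m s \<kappa> p)"
proof -
  have expand: "raise m s (\<kappa> + 2) (raise m u \<kappa> p) \<alpha> =
      fnorm2 m (fnorm2 m (fdiff s (fdiff u p))) \<alpha>
      - \<kappa> *\<^sub>R (fnorm2 m (fmul s (fdiff u p)) \<alpha> + fnorm2 m (fmul u (fdiff s p)) \<alpha>)
      - (if s = u then \<kappa> *\<^sub>R fnorm2 m p \<alpha> else 0)
      + (\<kappa> * (\<kappa> + 2)) *\<^sub>R fmul s (fmul u p) \<alpha>" if "s \<le> m" for s u \<alpha>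
  proof -
    have e: "fdiff s (raise m u \<kappa> p) = (\<lambda>\<alpha>. (fnorm2 m (fdiff s (fdiff u p)) \<alpha>
        + 2 *\<^sub>R fmul s (fdiff u p) \<alpha>)
        - \<kappa> *\<^sub>R (fmul u (fdiff s p) \<alpha> + (if s = u then 1 else 0) *\<^sub>R p \<alpha>))"
      unfolding raise_eq by (simp add: fun_eq_iff fdiff_lin fdiff_fnorm2[OF that] fdiff_fmul)
    have "raise m s (\<kappa> + 2) (raise m u \<kappa> p) \<alpha> =
        fnorm2 m (fdiff s (raise m u \<kappa> p)) \<alpha> - (\<kappa> + 2) *\<^sub>R fmul s (raise m u \<kappa> p) \<alpha>"
      by (rule raise_def)
    also have "fmul s (raise m u \<kappa> p) \<alpha> =
        fnorm2 m (fmul s (fdiff u p)) \<alpha> - \<kappa> *\<^sub>R fmul s (fmul u p) \<alpha>"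
      unfolding raise_eq fmul_lin fmul_fnorm2 ..
    finally show ?thesis
      unfolding e fnorm2_lin by (cases "s = u") (simp_all add: algebra_simps scaleR_2)
  qed
  show ?thesis
    using expand[OF assms(1), of u] expand[OF assms(2), of s]
    by (auto simp: fun_eq_iff fdiff_fdiff[of s] fmul_fmul[of s] add.commute)
qed

text \<open>
  The value at the point with coordinates \<open>w\<close> of the homogeneous part of degree \<open>d\<close>.
\<close>

definition feval :: "nat \<Rightarrow> nat \<Rightarrow> 'a::real_vector coeffs \<Rightarrow> (nat \<Rightarrow> real) \<Rightarrow> 'a" where
  "feval m d p w = (\<Sum>\<alpha>\<in>multi_indices_deg {..m} d. (\<Prod>s\<le>m. w s ^ \<alpha> s) *\<^sub>R p \<alpha>)"

lemma prod_power_Suc: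
  fixes w :: "'i \<Rightarrow> 'b::comm_semiring_1"
  assumes "finite I" "s \<in> I"
  shows "(\<Prod>i\<in>I. w i ^ (\<alpha>(s := Suc (\<alpha> s))) i) = w s * (\<Prod>i\<in>I. w i ^ \<alpha> i)"
proof -
  have "(\<Prod>i\<in>I - {s}. w i ^ (\<alpha>(s := Suc (\<alpha> s))) i) = (\<Prod>i\<in>I - {s}. w i ^ \<alpha> i)"
    by (intro prod.cong) auto
  then show ?thesis
    using assms by (simp add: prod.remove[of I s] mult.assoc)
qed

lemma feval_0: "feval m 0 p w = p (\<lambda>_. 0)"
  by (simp add: feval_def multi_indices_deg_0)

lemma feval_fmul:
  assumes "s \<le> m"
  shows "feval m (Suc d) (fmul s p) w = w s *\<^sub>R feval m d p w"
proof -
  have "feval m (Suc d) (fmul s p) w = (\<Sum>\<alpha>\<in>multi_indices_deg {..m} (Suc d).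
      if \<alpha> s = 0 then 0 else (\<Prod>s\<le>m. w s ^ \<alpha> s) *\<^sub>R p (\<alpha>(s := \<alpha> s - 1)))"
    unfolding feval_def fmul_def by (intro sum.cong) auto
  then show ?thesis
    using assms by (simp add: sum_multi_indices_deg_Suc prod_power_Suc feval_def scaleR_sum_right
        del: fun_upd_apply) simp
qed

lemma feval_lin:
  "feval m d (\<lambda>\<alpha>. p \<alpha> - q \<alpha>) w = feval m d p w - feval m d q w"
  "feval m d (\<lambda>\<alpha>. r *\<^sub>R p \<alpha>) w = r *\<^sub>R feval m d p w"
  "feval m d (\<lambda>\<alpha>. \<Sum>i\<in>A. P i \<alpha>) w = (\<Sum>i\<in>A. feval m d (P i) w)"
  by (simp_all add: feval_def scaleR_right_diff_distrib sum_subtractf scaleR_sum_right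
      sum.swap[of _ A] mult.commute)

lemma feval_fnorm2: "feval m (d + 2) (fnorm2 m p) w = (\<Sum>u\<le>m. (w u)\<^sup>2) *\<^sub>R feval m d p w"
proof -
  have "fnorm2 m p = (\<lambda>\<alpha>. \<Sum>u\<le>m. fmul u (fmul u p) \<alpha>)"
    by (simp add: fun_eq_iff fnorm2_def)
  then show ?thesis
    by (simp add: feval_lin feval_fmul scaleR_sum_left power2_eq_square)
qed

lemma feval_raise:
  assumes "s \<le> m"
  shows "feval m (d + 2) (raise m s \<kappa> p) w =
    (\<Sum>u\<le>m. (w u)\<^sup>2) *\<^sub>R feval m d (fdiff s p) w - (\<kappa> * w s) *\<^sub>R feval m (Suc d) p w"
  unfolding raise_eq feval_lin feval_fnorm2 using assms by (simp add: feval_fmul)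

lemma has_real_derivative_prod_power:
  fixes w :: "nat \<Rightarrow> real \<Rightarrow> real"
  assumes "\<And>s. s \<le> m \<Longrightarrow> (w s has_real_derivative w' s) (at t)"
  shows "((\<lambda>t. \<Prod>s\<le>m. w s t ^ \<alpha> s) has_real_derivative
    (\<Sum>s\<le>m. if \<alpha> s = 0 then 0
      else real (\<alpha> s) * (w' s * (\<Prod>i\<le>m. w i t ^ (\<alpha>(s := \<alpha> s - 1)) i)))) (at t)"
proof -
  have "((\<lambda>t. \<Prod>s\<le>m. w s t ^ \<alpha> s) has_real_derivative
      (\<Sum>s\<le>m. real (\<alpha> s) * (w' s * w s t ^ (\<alpha> s - 1)) * (\<Prod>i\<in>{..m} - {s}. w i t ^ \<alpha> i))) (at t)"
    by (rule has_field_derivative_prod, rule DERIV_cong, rule DERIV_power, rule assms)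
      (simp_all add: mult_ac)
  moreover have "real (\<alpha> s) * (w' s * w s t ^ (\<alpha> s - 1)) * (\<Prod>i\<in>{..m} - {s}. w i t ^ \<alpha> i) =
      (if \<alpha> s = 0 then 0
       else real (\<alpha> s) * (w' s * (\<Prod>i\<le>m. w i t ^ (\<alpha>(s := \<alpha> s - 1)) i)))" if "s \<le> m" for s
  proof -
    have "(\<Prod>i\<in>{..m} - {s}. w i t ^ (\<alpha>(s := \<alpha> s - 1)) i) = (\<Prod>i\<in>{..m} - {s}. w i t ^ \<alpha> i)"
      by (intro prod.cong) auto
    then show ?thesis
      using that by (simp add: prod.remove[of "{..m}" s])
  qed
  ultimately show ?thesis
    by simp
qed

lemma feval_has_vector_derivative:
  fixes p :: "'a::real_normed_vector coeffs"
  assumes "\<And>s. s \<le> m \<Longrightarrow> ((\<lambda>t. w t s) has_real_derivative w' s) (at t)"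
  shows "((\<lambda>t. feval m (Suc d) p (w t)) has_vector_derivative
    (\<Sum>s\<le>m. w' s *\<^sub>R feval m d (fdiff s p) (w t))) (at t)"
proof -
  let ?D = "\<lambda>s \<alpha>. real (\<alpha> s) * (w' s * (\<Prod>i\<le>m. w t i ^ (\<alpha>(s := \<alpha> s - 1)) i))"
  have "((\<lambda>t. feval m (Suc d) p (w t)) has_vector_derivative
    (\<Sum>\<alpha>\<in>multi_indices_deg {..m} (Suc d). (\<Sum>s\<le>m. if \<alpha> s = 0 then 0 else ?D s \<alpha>) *\<^sub>R p \<alpha>)) (at t)"
    unfolding feval_def
    by (intro has_vector_derivative_sum has_vector_derivative_scaleR[where g' = 0, simplified]
        has_real_derivative_prod_power[where w = "\<lambda>s t. w t s"] assms) simp_all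
  also have "(\<Sum>\<alpha>\<in>multi_indices_deg {..m} (Suc d). (\<Sum>s\<le>m. if \<alpha> s = 0 then 0 else ?D s \<alpha>) *\<^sub>R p \<alpha>) =
      (\<Sum>s\<le>m. \<Sum>\<alpha>\<in>multi_indices_deg {..m} (Suc d). if \<alpha> s = 0 then 0 else ?D s \<alpha> *\<^sub>R p \<alpha>)"
    unfolding scaleR_sum_left
    by (subst sum.swap) (intro sum.cong, auto)
  also have "\<dots> = (\<Sum>s\<le>m. w' s *\<^sub>R feval m d (fdiff s p) (w t))"
    by (intro sum.cong refl, subst sum_multi_indices_deg_Suc)
       (simp_all add: feval_def fdiff_def scaleR_sum_right mult_ac del: of_nat_Suc)
  finally show ?thesis .
qed

text \<open>
  The sum of the norms of the coefficients controls the values of a polynomial, and, unlike a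
  supremum norm, is bounded under \<open>fdiff\<close> by a direct estimate of the coefficients.
\<close>

definition fsize :: "nat \<Rightarrow> nat \<Rightarrow> 'a::real_normed_vector coeffs \<Rightarrow> real" where
  "fsize m d p = (\<Sum>\<alpha>\<in>multi_indices_deg {..m} d. norm (p \<alpha>))"

lemma fsize_nonneg: "0 \<le> fsize m d p"
  by (simp add: fsize_def sum_nonneg)

lemma fsize_fmul:
  assumes "s \<le> m"
  shows "fsize m (Suc d) (fmul s p) = fsize m d p"
proof -
  have "fsize m (Suc d) (fmul s p) = (\<Sum>\<alpha>\<in>multi_indices_deg {..m} (Suc d).
      if \<alpha> s = 0 then 0 else norm (p (\<alpha>(s := \<alpha> s - 1))))"
    unfolding fsize_def fmul_def by (intro sum.cong) auto
  then show ?thesis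
    using assms by (simp add: sum_multi_indices_deg_Suc fsize_def)
qed

lemma fsize_fdiff:
  assumes "s \<le> m"
  shows "fsize m d (fdiff s p) \<le> real (Suc d) * fsize m (Suc d) p"
proof -
  have le: "\<alpha> s \<le> Suc d" if "\<alpha> \<in> multi_indices_deg {..m} (Suc d)" for \<alpha>
    using that assms member_le_sum[of s "{..m}" \<alpha>] by (auto simp: multi_indices_deg_def)
  have "fsize m d (fdiff s p) = (\<Sum>\<alpha>\<in>multi_indices_deg {..m} (Suc d).
      if \<alpha> s = 0 then 0 else real (\<alpha> s) * norm (p \<alpha>))"
    using assms by (subst sum_multi_indices_deg_Suc)
      (simp_all add: fsize_def fdiff_def del: of_nat_Suc)
  also have "\<dots> \<le> (\<Sum>\<alpha>\<in>multi_indices_deg {..m} (Suc d). real (Suc d) * norm (p \<alpha>))"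
    using le by (intro sum_mono) (auto intro!: mult_right_mono simp del: of_nat_Suc)
  finally show ?thesis
    by (simp add: fsize_def sum_distrib_left)
qed

text \<open>
  One differentiation costs a factor linear in the degree, so \<open>n\<close> of them cost a factor
  \<open>C\<^sup>n n!\<close>.
\<close>

lemma fsize_raise:
  assumes "s \<le> m" "0 \<le> \<kappa>"
  shows "fsize m (d + 2) (raise m s \<kappa> p) \<le> (real (Suc m) * real (Suc d) + \<kappa>) * fsize m (Suc d) p"
proof -
  have "fsize m (d + 2) (raise m s \<kappa> p) \<le> (\<Sum>\<alpha>\<in>multi_indices_deg {..m} (d + 2).
      (\<Sum>u\<le>m. norm (fmul u (fmul u (fdiff s p)) \<alpha>)) + \<kappa> * norm (fmul s p \<alpha>))"
    unfolding fsize_def raise_def fnorm2_def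
    by (intro sum_mono order_trans[OF norm_triangle_ineq4] add_mono norm_sum)
      (use assms in auto)
  also have "\<dots> = (\<Sum>u\<le>m. fsize m (d + 2) (fmul u (fmul u (fdiff s p)))) + \<kappa> * fsize m (d + 2) (fmul s p)"
    unfolding fsize_def sum.distrib sum_distrib_left by (subst sum.swap) simp
  also have "\<dots> = real (Suc m) * fsize m d (fdiff s p) + \<kappa> * fsize m (Suc d) p"
    using assms by (simp add: fsize_fmul)
  also have "\<dots> \<le> real (Suc m) * (real (Suc d) * fsize m (Suc d) p) + \<kappa> * fsize m (Suc d) p"
    using assms by (intro add_right_mono mult_left_mono fsize_fdiff) auto
  finally show ?thesis
    by (simp add: algebra_simps)
qed

lemma norm_feval_le:
  assumes "\<And>s. s \<le> m \<Longrightarrow> \<bar>w s\<bar> \<le> b"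
  shows "norm (feval m d p w) \<le> fsize m d p * b ^ d"
proof -
  have "\<bar>\<Prod>s\<le>m. w s ^ \<alpha> s\<bar> \<le> b ^ d" if "\<alpha> \<in> multi_indices_deg {..m} d" for \<alpha>
  proof -
    have "\<bar>\<Prod>s\<le>m. w s ^ \<alpha> s\<bar> = (\<Prod>s\<le>m. \<bar>w s\<bar> ^ \<alpha> s)"
      by (simp add: abs_prod power_abs)
    also have "\<dots> \<le> (\<Prod>s\<le>m. b ^ \<alpha> s)"
      using assms by (intro prod_mono conjI power_mono) auto
    also have "\<dots> = b ^ d"
      using that by (simp add: power_sum[symmetric] multi_indices_deg_def)
    finally show ?thesis .
  qed
  then show ?thesis
    unfolding feval_def fsize_def sum_distrib_right
    by (intro sum_norm_le) (simp add: mult.commute[of _ "b ^ d"] mult_right_mono)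
qed

section \<open>The Cauchy kernel and its derivatives\<close>

lemma DERIV_norm_line:
  fixes x y :: "'a::real_inner"
  assumes nz: "y + t *\<^sub>R x \<noteq> 0"
  shows "((\<lambda>t. norm (y + t *\<^sub>R x)) has_real_derivative
    ((y + t *\<^sub>R x) \<bullet> x) / norm (y + t *\<^sub>R x)) (at t)"
proof -
  have "((\<lambda>t. norm (y + t *\<^sub>R x)) has_derivative
      (\<lambda>h. (h *\<^sub>R x) \<bullet> sgn (y + t *\<^sub>R x))) (at t)"
    by (rule has_derivative_compose[where f = "\<lambda>t. y + t *\<^sub>R x" and g = norm, OF _ has_derivative_norm[OF nz]])
      (auto intro!: derivative_eq_intros)
  then show ?thesis
    by (simp add: has_field_derivative_def sgn_div_norm inner_commute divide_inverse
        mult_ac mult_commute_abs)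
qed

lemma DERIV_norm_power_line:
  fixes x y :: "'a::real_inner"
  assumes "y + t *\<^sub>R x \<noteq> 0"
  shows "((\<lambda>t. 1 / norm (y + t *\<^sub>R x) ^ k) has_real_derivative
    - (real k * ((y + t *\<^sub>R x) \<bullet> x) / norm (y + t *\<^sub>R x) ^ (k + 2))) (at t)"
proof -
  let ?n = "norm (y + t *\<^sub>R x)" and ?d = "(y + t *\<^sub>R x) \<bullet> x"
  have "((\<lambda>t. inverse (norm (y + t *\<^sub>R x) ^ k)) has_real_derivative
      - (inverse (?n ^ k) * (real k * ?n ^ (k - 1) * (?d / ?n)) * inverse (?n ^ k))) (at t)"
    by (rule DERIV_inverse', rule DERIV_cong, rule DERIV_power[OF DERIV_norm_line[OF assms]])
      (use assms in simp_all)
  moreover have "inverse (?n ^ k) * (real k * ?n ^ (k - 1) * (?d / ?n)) * inverse (?n ^ k) =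
      real k * ?d / ?n ^ (k + 2)"
    using assms by (cases k) (simp_all add: divide_simps)
  ultimately show ?thesis
    by (simp only: inverse_eq_divide)
qed

locale hypercomplex =
  fixes c :: "'a::{euclidean_space, real_algebra_1} \<Rightarrow> 'a"
    and M :: "'a set" and v :: "nat \<Rightarrow> 'a" and m :: nat
  assumes inv: "star_involution c"
    and basis: "hypercomplex_basis c M m v"
    and orth: "orthonormal_family v m"
begin

lemma inner_basis: "i \<le> m \<Longrightarrow> j \<le> m \<Longrightarrow> v i \<bullet> v j = (if i = j then 1 else 0)"
  using orth by (simp add: orthonormal_family_def)

lemma M_span: "M = span (v ` {..m})"
  using basis by (auto simp: hypercomplex_basis_def ordered_basis_def)

lemma subspace_M: "subspace M"
  by (simp add: M_span)

lemma v_in_M: "s \<le> m \<Longrightarrow> v s \<in> M"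
  by (auto simp: M_span intro: span_base)

lemma v_0: "v 0 = 1"
  using basis by (simp add: hypercomplex_basis_def)

lemma expansion:
  assumes "x \<in> M"
  shows "x = (\<Sum>s\<le>m. (x \<bullet> v s) *\<^sub>R v s)"
  using assms unfolding M_span
proof (induction rule: span_induct_alt)
  case base
  then show ?case by simp
next
  case (step r b y)
  then obtain i where i: "i \<le> m" "b = v i"
    by auto
  have "(\<Sum>s\<le>m. ((r *\<^sub>R b + y) \<bullet> v s) *\<^sub>R v s) =
      (\<Sum>s\<le>m. if i = s then r *\<^sub>R v i else 0) + (\<Sum>s\<le>m. (y \<bullet> v s) *\<^sub>R v s)"
    unfolding sum.distrib[symmetric]
    by (intro sum.cong refl) (auto simp: i inner_basis inner_add_left scaleR_left_distrib)
  then show ?case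
    using i step.IH by simp
qed

lemma inner_expansion:
  assumes "x \<in> M"
  shows "x \<bullet> y = (\<Sum>s\<le>m. (x \<bullet> v s) * (y \<bullet> v s))"
  by (subst expansion[OF assms]) (simp add: inner_sum_left inner_commute[of "v _" y])

lemma norm_expansion:
  assumes "x \<in> M"
  shows "(\<Sum>s\<le>m. (x \<bullet> v s)\<^sup>2) = (norm x)\<^sup>2"
  using inner_expansion[OF assms, of x] by (simp only: power2_norm_eq_inner power2_eq_square[of "_ \<bullet> _"])

lemma linear_c: "linear c"
  using inv by (simp add: star_involution_def)

lemma c_1: "c 1 = 1"
proof -
  have *: "c (c x) = x" "c (x * y) = c y * c x" for x y
    using inv by (auto simp: star_involution_def)
  have "c (c 1 * 1) = c 1"
    by (subst *(2)) (simp add: *(1))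
  then show ?thesis
    by (simp add: *(1))
qed

lemma c_v: "c (v s) = (if s = 0 then 1 else - v s)" if "s \<le> m"
proof (cases "s = 0")
  case True
  then show ?thesis by (simp add: v_0 c_1)
next
  case False
  then have "v s \<in> imaginary_units c"
    using that basis by (auto simp: hypercomplex_basis_def)
  then show ?thesis
    using False by (simp add: imaginary_units_def star_trace_def eq_neg_iff_add_eq_0 add.commute)
qed

lemma c_v_in_M: "s \<le> m \<Longrightarrow> c (v s) \<in> M"
  using v_in_M[of s] v_in_M[of 0] subspace_neg[OF subspace_M]
  by (auto simp: c_v v_0)

lemma v_mult_c_v_same: "s \<le> m \<Longrightarrow> v s * c (v s) = 1"
  using basis by (cases "s = 0")
    (auto simp: v_0 c_1 hypercomplex_basis_def imaginary_units_def star_norm_def)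

text \<open>
  The polarised form of \<open>v\<^sub>s c(v\<^sub>s) = 1\<close>; for \<open>s \<noteq> u\<close> it combines the anticommutation of the imaginary
  basis elements with \<open>c(v\<^sub>s) = - v\<^sub>s\<close>, the two signs cancelling when one index is \<open>0\<close>.
\<close>

lemma v_mult_c_v:
  assumes "s \<le> m" "u \<le> m"
  shows "v s * c (v u) + v u * c (v s) = (if s = u then 2 else 0)"
proof -
  consider "s = u" | "s = 0" "u \<noteq> 0" | "s \<noteq> 0" "u = 0" | "s \<noteq> 0" "u \<noteq> 0" "s \<noteq> u"
    by auto
  then show ?thesis
  proof cases
    case 1
    then show ?thesis
      using v_mult_c_v_same[OF assms(1)] by simp
  next
    case 4
    have "\<forall>s\<in>{1..m}. \<forall>u\<in>{1..m}. s \<noteq> u \<longrightarrow> v s * v u = - (v u * v s)"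
      using basis unfolding hypercomplex_basis_def by blast
    moreover have "s \<in> {1..m}" "u \<in> {1..m}"
      using 4 assms by auto
    ultimately have "v s * v u = - (v u * v s)"
      using 4(3) by blast
    then have "v s * v u + v u * v s = 0"
      by (simp only: eq_neg_iff_add_eq_0)
    moreover have "v s * c (v u) + v u * c (v s) = - (v s * v u + v u * v s)"
      using 4 assms by (simp add: c_v)
    ultimately show ?thesis
      using 4(3) by simp
  qed (use assms in \<open>simp_all add: c_v v_0 c_1\<close>)
qed

lemma c_expansion:
  assumes "x \<in> M"
  shows "c x = (\<Sum>s\<le>m. (x \<bullet> v s) *\<^sub>R c (v s))"
  by (subst expansion[OF assms]) (simp add: linear_sum[OF linear_c] linear_scale[OF linear_c] o_def)

lemma c_in_M: "x \<in> M \<Longrightarrow> c x \<in> M"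
  by (subst c_expansion) (auto intro!: subspace_sum subspace_M subspace_scale c_v_in_M)

lemma norm_c:
  assumes "x \<in> M"
  shows "norm (c x) = norm x"
proof -
  have "c x \<bullet> v s = (if s = 0 then x \<bullet> v s else - (x \<bullet> v s))" if "s \<le> m" for s
  proof -
    have "c x \<bullet> v s = (\<Sum>u\<le>m. if u = s then (if s = 0 then x \<bullet> v s else - (x \<bullet> v s)) else 0)"
      unfolding c_expansion[OF assms] inner_sum_left
      by (intro sum.cong refl) (use that in \<open>auto simp: c_v inner_basis v_0[symmetric]\<close>)
    then show ?thesis
      using that by simp
  qed
  then have "(norm (c x))\<^sup>2 = (norm x)\<^sup>2"
    unfolding norm_expansion[OF c_in_M[OF assms], symmetric] norm_expansion[OF assms, symmetric]
    by (intro sum.cong refl) auto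
  then show ?thesis
    by simp
qed

text \<open>
  The coefficients of the linear polynomial function \<open>w \<mapsto> c w\<close> on \<open>M\<close>.
\<close>

definition conj_coeffs :: "'a coeffs" where
  "conj_coeffs \<alpha> = (\<Sum>u\<le>m. fmul u (fconst (c (v u))) \<alpha>)"

text \<open>
  The numerator is accompanied by the exponent \<open>\<kappa>\<close> of its denominator \<open>\<bar>w\<bar>\<^sup>\<kappa>\<close>, which grows by \<open>2\<close> at each
  differentiation. Indices above \<open>m\<close> do nothing, so that the steps commute for all pairs of natural
  numbers, as a fold over multisets requires.
\<close>

definition raise_step :: "nat \<Rightarrow> real \<times> 'a coeffs \<Rightarrow> real \<times> 'a coeffs" where
  "raise_step s = (\<lambda>(\<kappa>, p). if s \<le> m then (\<kappa> + 2, raise m s \<kappa> p) else (\<kappa>, p))"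

definition kernel_coeffs :: "nat multiset \<Rightarrow> 'a coeffs" where
  "kernel_coeffs B = snd (fold_mset raise_step (real m + 1, conj_coeffs) B)"

lemma comp_fun_commute_raise_step: "comp_fun_commute raise_step"
  by standard (auto simp: fun_eq_iff raise_step_def raise_raise)

lemma kernel_coeffs_empty: "kernel_coeffs {#} = conj_coeffs"
  by (simp add: kernel_coeffs_def)

lemma kernel_coeffs_add:
  assumes "set_mset B \<subseteq> {..m}" "s \<le> m"
  shows "kernel_coeffs (add_mset s B) = raise m s (real (m + 1 + 2 * size B)) (kernel_coeffs B)"
proof -
  interpret comp_fun_commute raise_step
    by (rule comp_fun_commute_raise_step)
  have "fst (fold_mset raise_step (real m + 1, conj_coeffs) B) = real (m + 1 + 2 * size B)"
    using assms(1) by (induction B) (auto simp: raise_step_def split: prod.split)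
  then show ?thesis
    using assms(2) by (auto simp: kernel_coeffs_def raise_step_def split: prod.split)
qed

lemma kernel_coeffs_induct [consumes 1, case_names empty add]:
  assumes "set_mset B \<subseteq> {..m}"
    and "P {#} conj_coeffs"
    and "\<And>s B. s \<le> m \<Longrightarrow> set_mset B \<subseteq> {..m} \<Longrightarrow> P B (kernel_coeffs B) \<Longrightarrow>
      P (add_mset s B) (raise m s (real (m + 1 + 2 * size B)) (kernel_coeffs B))"
  shows "P B (kernel_coeffs B)"
  using assms(1)
proof (induction B)
  case empty
  then show ?case
    by (simp only: kernel_coeffs_empty assms(2))
next
  case (add s B)
  then have *: "s \<le> m" "set_mset B \<subseteq> {..m}" "P B (kernel_coeffs B)"
    by auto
  from assms(3)[OF *] show ?case
    by (simp only: kernel_coeffs_add[OF *(2,1)])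
qed

lemma kernel_coeffs_in_M:
  assumes "set_mset B \<subseteq> {..m}"
  shows "kernel_coeffs B \<alpha> \<in> M"
proof -
  note [simp] = subspace_0[OF subspace_M] c_v_in_M
  have mul: "fmul s p \<alpha> \<in> M" if "\<And>\<alpha>. p \<alpha> \<in> M" for s p \<alpha>
    using that by (auto simp: fmul_def)
  have "\<forall>\<alpha>. kernel_coeffs B \<alpha> \<in> M"
    using assms
  proof (induction rule: kernel_coeffs_induct)
    case empty
    then show ?case
      by (auto simp: conj_coeffs_def fconst_def intro!: subspace_sum subspace_M mul)
  next
    case (add s B)
    then show ?case
      by (auto simp: raise_def fnorm2_def fdiff_def
          intro!: subspace_sum subspace_M subspace_diff subspace_scale mul)
  qed
  then show ?thesis ..
qed

lemma fdiff_conj_coeffs: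
  assumes "s \<le> m"
  shows "fdiff s conj_coeffs = fconst (c (v s))"
proof
  fix \<alpha>
  have 0: "fmul u (fdiff s (fconst a)) \<alpha> = 0" for u and a :: 'a
    by (simp add: fmul_def fdiff_fconst)
  have "fdiff s conj_coeffs \<alpha> = (\<Sum>u\<le>m. if s = u then fconst (c (v s)) \<alpha> else 0)"
    unfolding conj_coeffs_def[abs_def] fdiff_lin fdiff_fmul 0
    by (intro sum.cong) auto
  then show "fdiff s conj_coeffs \<alpha> = fconst (c (v s)) \<alpha>"
    using assms by simp
qed

text \<open>
  The Dirac equation for \<open>c w / \<bar>w\<bar>\<^sup>m\<^sup>+\<^sup>1\<close>. Up to the common factor \<open>1 / \<bar>w\<bar>\<^sup>m\<^sup>+\<^sup>1\<close>, differentiating the numerator yields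
  \<open>\<Sum>\<^sub>s v\<^sub>s c(v\<^sub>s) = m + 1\<close>, differentiating the denominator yields \<open>- (m + 1) (\<Sum>\<^sub>s w\<^sub>s v\<^sub>s) c w / \<bar>w\<bar>\<^sup>2\<close>,
  and \<open>w * c w = \<bar>w\<bar>\<^sup>2\<close>. The last identity appears here in terms of coefficients.
\<close>

lemma dirac_conj_coeffs: "(\<Sum>s\<le>m. v s * raise m s (real m + 1) conj_coeffs \<alpha>) = 0"
proof -
  let ?X = "\<lambda>s u a. fmul s (fmul u (fconst a)) \<alpha> :: 'a"
  have mult: "a * ?X s u b = ?X s u (a * b)" for a b s u
    by (auto simp: fmul_def fconst_def)
  have add: "?X s u a + ?X s u b = ?X s u (a + b)" for a b s u
    by (auto simp: fmul_def fconst_def)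
  have scale: "r *\<^sub>R ?X s u b = ?X s u (r *\<^sub>R b)" for r b s u
    by (auto simp: fmul_def fconst_def)
  have swap: "?X u s a = ?X s u a" for a s u
    by (simp only: fmul_fmul[of u s])
  have zero: "?X s u 0 = 0" for s u
    by (auto simp: fmul_def fconst_def)
  let ?S = "\<Sum>s\<le>m. \<Sum>u\<le>m. ?X s u (v s * c (v u))"
  \<comment> \<open>The double sum \<open>?S\<close> is \<open>w * c w\<close>. It is symmetrised so that the off-diagonal terms cancel.\<close>
  have "?S + ?S = ?S + (\<Sum>u\<le>m. \<Sum>s\<le>m. ?X s u (v s * c (v u)))"
    by (rule arg_cong[where f = "\<lambda>z. ?S + z"], rule sum.swap)
  also have "\<dots> = (\<Sum>s\<le>m. \<Sum>u\<le>m. ?X s u (v s * c (v u) + v u * c (v s)))"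
    unfolding sum.distrib[symmetric] by (intro sum.cong refl) (simp add: add[symmetric] swap)
  also have "\<dots> = (\<Sum>s\<le>m. \<Sum>u\<le>m. if s = u then ?X s s 2 else 0)"
    by (intro sum.cong refl) (auto simp: v_mult_c_v zero)
  also have "\<dots> = (\<Sum>s\<le>m. ?X s s 2)"
    by simp
  also have "\<dots> = (\<Sum>s\<le>m. ?X s s 1) + (\<Sum>s\<le>m. ?X s s 1)"
    by (simp add: sum.distrib[symmetric] add)
  finally have S: "?S = (\<Sum>s\<le>m. ?X s s 1)"
    by (metis (no_types, lifting) scaleR_2 scaleR_cancel_left zero_neq_numeral)
  have r: "raise m s (real m + 1) conj_coeffs \<alpha> =
      (\<Sum>u\<le>m. ?X u u (c (v s))) - (real m + 1) *\<^sub>R (\<Sum>u\<le>m. ?X s u (c (v u)))"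
    if "s \<le> m" for s
    unfolding raise_def fdiff_conj_coeffs[OF that]
    by (simp only: fnorm2_def conj_coeffs_def[abs_def] fmul_lin)
  have "(\<Sum>s\<le>m. v s * raise m s (real m + 1) conj_coeffs \<alpha>) =
     (\<Sum>s\<le>m. \<Sum>u\<le>m. ?X u u (v s * c (v s))) - (real m + 1) *\<^sub>R ?S"
    by (simp add: r right_diff_distrib sum_distrib_left sum_subtractf scaleR_sum_right mult)
  also have "(\<Sum>s\<le>m. \<Sum>u\<le>m. ?X u u (v s * c (v s))) = (\<Sum>s\<le>m. \<Sum>u\<le>m. ?X u u 1)"
    by (intro sum.cong refl) (simp add: v_mult_c_v_same)
  also have "\<dots> = (real m + 1) *\<^sub>R (\<Sum>u\<le>m. ?X u u 1)"
    by (simp add: scaleR_conv_of_real add.commute)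
  finally show ?thesis
    by (simp add: S)
qed

text \<open>
  Left multiplication by \<open>v\<^sub>s\<close> and further differentiation commute, and so the Dirac equation
  passes to all derivatives.
\<close>

lemma dirac_kernel_coeffs:
  assumes "set_mset B \<subseteq> {..m}"
  shows "(\<Sum>s\<le>m. v s * kernel_coeffs (add_mset s B) \<alpha>) = 0"
  using assms
proof (induction B arbitrary: \<alpha>)
  case empty
  then show ?case
    using dirac_conj_coeffs by (simp add: kernel_coeffs_add kernel_coeffs_empty add.commute)
next
  case (add u B)
  let ?r = "raise m u (real (m + 1 + 2 * Suc (size B)))"
  have "(\<Sum>s\<le>m. v s * kernel_coeffs (add_mset s (add_mset u B)) \<alpha>) =
      (\<Sum>s\<le>m. v s * ?r (kernel_coeffs (add_mset s B)) \<alpha>)"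
    using add.prems
    by (intro sum.cong refl) (subst add_mset_commute, subst kernel_coeffs_add, auto)
  also have "\<dots> = ?r (\<lambda>\<alpha>. \<Sum>s\<le>m. v s * kernel_coeffs (add_mset s B) \<alpha>) \<alpha>"
    by (simp only: raise_lin raise_mult_left)
  also have "\<dots> = ?r (\<lambda>_. 0) \<alpha>"
    using add by simp
  also have "\<dots> = 0"
    using raise_lin[where A = "{}" and P = "\<lambda>_ _. 0 :: 'a"] by simp
  finally show ?case .
qed

definition coord :: "'a \<Rightarrow> nat \<Rightarrow> real" where
  "coord x s = x \<bullet> v s"

text \<open>
  The iterated partial derivative of \<open>w \<mapsto> c w / \<bar>w\<bar>\<^sup>m\<^sup>+\<^sup>1\<close> in the directions of \<open>B\<close>, see
  \<open>kernel_diff_empty\<close> and \<open>kernel_diff_has_vector_derivative\<close>.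
\<close>

definition kernel_diff :: "nat multiset \<Rightarrow> 'a \<Rightarrow> 'a" where
  "kernel_diff B w = (1 / norm w ^ (m + 1 + 2 * size B)) *\<^sub>R
     feval m (Suc (size B)) (kernel_coeffs B) (coord w)"

lemma feval_conj_coeffs: "x \<in> M \<Longrightarrow> feval m (Suc 0) conj_coeffs (coord x) = c x"
  unfolding conj_coeffs_def[abs_def] feval_lin
  by (simp add: feval_fmul feval_0 fconst_def c_expansion coord_def)

lemma kernel_diff_empty: "x \<in> M \<Longrightarrow> kernel_diff {#} x = (1 / norm x ^ (m + 1)) *\<^sub>R c x"
  by (simp add: kernel_diff_def kernel_coeffs_empty feval_conj_coeffs)

lemma feval_kernel_coeffs_in_M:
  "set_mset B \<subseteq> {..m} \<Longrightarrow> feval m d (kernel_coeffs B) w \<in> M"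
  unfolding feval_def
  by (intro subspace_sum subspace_M subspace_scale kernel_coeffs_in_M)

lemma dirac_kernel_diff:
  assumes "set_mset B \<subseteq> {..m}"
  shows "(\<Sum>s\<le>m. v s * kernel_diff (add_mset s B) w) = 0"
proof -
  have "(\<Sum>s\<le>m. v s * kernel_diff (add_mset s B) w) =
    (1 / norm w ^ (m + 1 + 2 * Suc (size B))) *\<^sub>R
     (\<Sum>s\<le>m. v s * feval m (Suc (Suc (size B))) (kernel_coeffs (add_mset s B)) (coord w))"
    by (simp add: kernel_diff_def scaleR_sum_right)
  also have "(\<Sum>s\<le>m. v s * feval m d (kernel_coeffs (add_mset s B)) (coord w)) =
      feval m d (\<lambda>\<alpha>. \<Sum>s\<le>m. v s * kernel_coeffs (add_mset s B) \<alpha>) (coord w)" for d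
    unfolding feval_lin by (simp add: feval_def sum_distrib_left)
  finally show ?thesis
    using assms by (simp add: dirac_kernel_coeffs feval_def)
qed

lemma kernel_diff_has_vector_derivative:
  assumes B: "set_mset B \<subseteq> {..m}" and xy: "x \<in> M" "y \<in> M" and nz: "y + t *\<^sub>R x \<noteq> 0"
  shows "((\<lambda>t. kernel_diff B (y + t *\<^sub>R x)) has_vector_derivative
    (\<Sum>s\<le>m. coord x s *\<^sub>R kernel_diff (add_mset s B) (y + t *\<^sub>R x))) (at t)"
proof -
  let ?w = "\<lambda>t. y + t *\<^sub>R x" and ?\<kappa> = "m + 1 + 2 * size B"
  let ?n = "norm (?w t)" and ?p = "kernel_coeffs B" and ?d = "size B"
  let ?e = "\<lambda>d p. feval m d p (coord (?w t))"
  have w: "?w t \<in> M"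
    using xy by (intro subspace_add subspace_scale subspace_M)
  have "((\<lambda>t. kernel_diff B (?w t)) has_vector_derivative
      (1 / ?n ^ ?\<kappa>) *\<^sub>R (\<Sum>s\<le>m. coord x s *\<^sub>R ?e ?d (fdiff s ?p))
      + (- (real ?\<kappa> * (?w t \<bullet> x) / ?n ^ (?\<kappa> + 2))) *\<^sub>R ?e (Suc ?d) ?p) (at t)"
    unfolding kernel_diff_def
    by (intro has_vector_derivative_scaleR DERIV_norm_power_line nz feval_has_vector_derivative)
      (auto simp: coord_def inner_add_left intro!: derivative_eq_intros)
  also have "(1 / ?n ^ ?\<kappa>) *\<^sub>R (\<Sum>s\<le>m. coord x s *\<^sub>R ?e ?d (fdiff s ?p))
      + (- (real ?\<kappa> * (?w t \<bullet> x) / ?n ^ (?\<kappa> + 2))) *\<^sub>R ?e (Suc ?d) ?p =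
      (\<Sum>s\<le>m. coord x s *\<^sub>R ((1 / ?n ^ ?\<kappa>) *\<^sub>R ?e ?d (fdiff s ?p)
        - (real ?\<kappa> * coord (?w t) s / ?n ^ (?\<kappa> + 2)) *\<^sub>R ?e (Suc ?d) ?p))"
    unfolding inner_expansion[OF w, of x]
    by (simp add: scaleR_right_diff_distrib sum_subtractf scaleR_sum_right sum_distrib_left
        sum_divide_distrib scaleR_sum_left coord_def mult_ac)
  also have "\<dots> = (\<Sum>s\<le>m. coord x s *\<^sub>R kernel_diff (add_mset s B) (?w t))"
  proof (rule sum.cong[OF refl])
    fix s assume s: "s \<in> {..m}"
    have "kernel_diff (add_mset s B) (?w t) = (1 / ?n ^ (?\<kappa> + 2)) *\<^sub>R
        ?e (?d + 2) (raise m s ?\<kappa> ?p)"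
      using B s by (simp add: kernel_diff_def kernel_coeffs_add)
    also have "\<dots> = (1 / ?n ^ (?\<kappa> + 2)) *\<^sub>R (?n\<^sup>2 *\<^sub>R ?e ?d (fdiff s ?p)
        - (real ?\<kappa> * coord (?w t) s) *\<^sub>R ?e (Suc ?d) ?p)"
      using s norm_expansion[OF w] by (subst feval_raise) (simp_all add: coord_def)
    finally show "coord x s *\<^sub>R ((1 / ?n ^ ?\<kappa>) *\<^sub>R ?e ?d (fdiff s ?p)
        - (real ?\<kappa> * coord (?w t) s / ?n ^ (?\<kappa> + 2)) *\<^sub>R ?e (Suc ?d) ?p) =
        coord x s *\<^sub>R kernel_diff (add_mset s B) (?w t)"
      using nz by (simp add: scaleR_right_diff_distrib power_add power2_eq_square)
  qed
  finally show ?thesis .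
qed

lemma fsize_kernel_coeffs:
  assumes "set_mset B \<subseteq> {..m}"
  shows "fsize m (Suc (size B)) (kernel_coeffs B) \<le>
    fact (size B) * (2 * real m + 4) ^ size B * fsize m 1 conj_coeffs"
  using assms
proof (induction B)
  case empty
  then show ?case by (simp add: kernel_coeffs_empty)
next
  case (add s B)
  let ?n = "size B" and ?f = "fsize m (Suc (size B)) (kernel_coeffs B)"
  have "fsize m (Suc (size (add_mset s B))) (kernel_coeffs (add_mset s B)) \<le>
      (real (Suc m) * real (Suc ?n) + real (m + 1 + 2 * ?n)) * ?f"
    using fsize_raise[of s m "real (m + 1 + 2 * ?n)" ?n "kernel_coeffs B"] add.prems
    by (simp add: kernel_coeffs_add)
  also have "\<dots> \<le> (real (Suc ?n) * (2 * real m + 4)) * ?f"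
  proof (intro mult_right_mono fsize_nonneg)
    have "0 \<le> real m * real ?n + 2"
      by simp
    then show "real (Suc m) * real (Suc ?n) + real (m + 1 + 2 * ?n) \<le> real (Suc ?n) * (2 * real m + 4)"
      by (simp add: algebra_simps)
  qed
  also have "\<dots> \<le> (real (Suc ?n) * (2 * real m + 4)) *
      (fact ?n * (2 * real m + 4) ^ ?n * fsize m 1 conj_coeffs)"
    using add by (intro mult_left_mono) auto
  finally show ?case
    by (simp add: mult_ac)
qed

text \<open>
  Growth of order \<open>C\<^sup>n n!\<close> is what a positive radius of convergence of the Taylor series requires.
\<close>

lemma norm_kernel_diff_le:
  assumes "w \<in> M" "w \<noteq> 0"
  obtains K C where "0 \<le> K" "0 < C"
    "\<And>B. set_mset B \<subseteq> {..m} \<Longrightarrow> norm (kernel_diff B w) \<le> K * C ^ size B * fact (size B)"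
proof
  let ?n = "norm w" and ?L = "2 * real m + 4" and ?F = "fsize m 1 conj_coeffs"
  show "0 \<le> ?F * ?n / ?n ^ (m + 1)"
    by (simp add: fsize_nonneg)
  show "0 < ?L * ?n / ?n\<^sup>2"
    using assms by simp
  fix B assume B: "set_mset B \<subseteq> {..m}"
  have "norm (feval m (Suc (size B)) (kernel_coeffs B) (coord w)) \<le>
      fsize m (Suc (size B)) (kernel_coeffs B) * ?n ^ Suc (size B)"
  proof (rule norm_feval_le)
    fix s assume "s \<le> m"
    then have "norm (v s) = 1"
      by (simp add: norm_eq_sqrt_inner inner_basis)
    then show "\<bar>coord w s\<bar> \<le> ?n"
      using Cauchy_Schwarz_ineq2[of w "v s"] by (simp add: coord_def)
  qed
  also have "\<dots> \<le> (fact (size B) * ?L ^ size B * ?F) * ?n ^ Suc (size B)"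
    by (intro mult_right_mono fsize_kernel_coeffs B) simp
  finally have le: "norm (feval m (Suc (size B)) (kernel_coeffs B) (coord w)) \<le>
    (fact (size B) * ?L ^ size B * ?F) * ?n ^ Suc (size B)" .
  have "norm (kernel_diff B w) =
      (1 / ?n ^ (m + 1 + 2 * size B)) * norm (feval m (Suc (size B)) (kernel_coeffs B) (coord w))"
    by (simp add: kernel_diff_def)
  also have "\<dots> \<le>
      (1 / ?n ^ (m + 1 + 2 * size B)) * ((fact (size B) * ?L ^ size B * ?F) * ?n ^ Suc (size B))"
    by (rule mult_left_mono[OF le]) simp
  also have "\<dots> = ?F * ?n / ?n ^ (m + 1) * (?L * ?n / ?n\<^sup>2) ^ size B * fact (size B)"
    by (simp add: power_add power_mult power_divide power_mult_distrib)
  finally show "norm (kernel_diff B w) \<le>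
      ?F * ?n / ?n ^ (m + 1) * (?L * ?n / ?n\<^sup>2) ^ size B * fact (size B)" .
qed

end

section \<open>Binomial series and Gegenbauer coefficients\<close>

text \<open>
  The Taylor coefficients of \<open>(1 - z)\<close> to the power \<open>- a\<close>.
\<close>

definition rising_coeff :: "real \<Rightarrow> nat \<Rightarrow> real" where
  "rising_coeff a n = pochhammer a n / fact n"

lemma rising_coeff_nonneg: "0 \<le> a \<Longrightarrow> 0 \<le> rising_coeff a n"
  by (simp add: rising_coeff_def pochhammer_prod prod_nonneg)

lemma rising_coeff_Suc_ge:
  assumes "1 \<le> a"
  shows "rising_coeff a n \<le> rising_coeff a (Suc n)"
proof -
  have "rising_coeff a (Suc n) = rising_coeff a n * ((a + real n) / (1 + real n))"
    by (simp add: rising_coeff_def pochhammer_Suc field_simps)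
  moreover have "1 \<le> (a + real n) / (1 + real n)"
    using assms by (simp add: field_simps)
  ultimately show ?thesis
    using rising_coeff_nonneg[of a n] assms
      mult_left_mono[of 1 "(a + real n) / (1 + real n)" "rising_coeff a n"]
    by simp
qed

lemma rising_coeff_convolution:
  "(\<Sum>i\<le>n. rising_coeff a i * rising_coeff b (n - i)) = rising_coeff (a + b) n"
proof -
  have "rising_coeff (a + b) n =
      (\<Sum>i\<le>n. real (n choose i) * pochhammer a i * pochhammer b (n - i) / fact n)"
    by (simp add: rising_coeff_def pochhammer_binomial_sum sum_divide_distrib)
  also have "\<dots> = (\<Sum>i\<le>n. rising_coeff a i * rising_coeff b (n - i))"
    by (intro sum.cong refl) (simp add: rising_coeff_def binomial_fact)
  finally show ?thesis ..
qed

lemma rising_coeff_Suc_nat: "rising_coeff (real m + 1) n = real ((n + m) choose m)"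
proof -
  have "real ((n + m) choose n) = rising_coeff (real m + 1) n"
    by (simp add: binomial_gbinomial gbinomial_pochhammer' rising_coeff_def)
  then show ?thesis
    using binomial_symmetric[of m "n + m"] by simp
qed

lemma rising_coeff_sums:
  assumes "cmod z < 1"
  shows "(\<lambda>n. of_real (rising_coeff a n) * z ^ n) sums ((1 - z) powr (- of_real a))"
proof -
  have "((- of_real a) gchoose n) * (- z) ^ n = of_real (rising_coeff a n) * z ^ n" for n
  proof -
    have "(- 1) ^ n * (- z) ^ n = z ^ n"
      by (simp flip: power_mult_distrib)
    then show ?thesis
      by (simp add: gbinomial_pochhammer rising_coeff_def mult_ac flip: pochhammer_of_real)
  qed
  then show ?thesis
    using gen_binomial_complex[of "- z" "- of_real a"] assms by simp
qed

text \<open>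
  The degree-\<open>n\<close> part of \<open>\<bar>1 - z\<bar>\<close> to the power \<open>- 2 a\<close>; for \<open>z = r e\<^sup>i\<^sup>\<theta>\<close> this is \<open>r\<^sup>n\<close> times the
  Gegenbauer polynomial \<open>C\<^sub>n\<^sup>(\<^sup>a\<^sup>)\<close> at \<open>cos \<theta>\<close>.
\<close>

definition gegenbauer :: "real \<Rightarrow> nat \<Rightarrow> complex \<Rightarrow> complex" where
  "gegenbauer a n z =
     (\<Sum>i\<le>n. (of_real (rising_coeff a i) * z ^ i) * (of_real (rising_coeff a (n - i)) * cnj z ^ (n - i)))"

lemma gegenbauer_real: "gegenbauer a n z = of_real (Re (gegenbauer a n z))"
proof -
  have "cnj (gegenbauer a n z) = (\<Sum>i\<le>n. (of_real (rising_coeff a (n - i)) * z ^ (n - i)) *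
      (of_real (rising_coeff a i) * cnj z ^ i))"
    by (simp add: gegenbauer_def mult_ac)
  also have "\<dots> = gegenbauer a n z"
    unfolding gegenbauer_def by (rule sum.reindex_bij_witness[of _ "\<lambda>i. n - i" "\<lambda>i. n - i"]) auto
  finally show ?thesis
    by (simp add: complex_eq_iff)
qed

lemma gegenbauer_scale: "gegenbauer a n (of_real t * z) = of_real (t ^ n) * gegenbauer a n z"
proof -
  have "of_real t ^ n = of_real t ^ i * (of_real t ^ (n - i) :: complex)" if "i \<le> n" for i
    using that by (simp flip: power_add)
  then show ?thesis
    unfolding gegenbauer_def sum_distrib_left
    by (intro sum.cong refl) (simp add: power_mult_distrib)
qed

text \<open>
  \<open>\<bar>1 - z\<bar>\<close> to the power \<open>- 2 a\<close> is the product of \<open>(1 - z)\<close> to the power \<open>- a\<close> and its conjugate, and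
  \<open>gegenbauer\<close> is the Cauchy product of the two binomial series.
\<close>

lemma gegenbauer_sums:
  assumes "cmod z < 1"
  shows "(\<lambda>n. Re (gegenbauer a n z)) sums (cmod (1 - z) powr (- (2 * a)))"
proof -
  let ?f = "\<lambda>z n. of_real (rising_coeff a n) * z ^ n :: complex"
  have nz: "1 - z \<noteq> 0" "Re (1 - z) > 0"
    using assms complex_Re_le_cmod[of z] by auto
  have sm: "summable (\<lambda>n. norm (?f w n))" if w: "cmod w < 1" for w
  proof -
    obtain r where r: "cmod w < r" "r < 1"
      using dense[OF w] by blast
    then have "cmod (of_real r) < 1"
      using norm_ge_zero[of w] unfolding norm_of_real by linarith
    then have "summable (?f (of_real r))"
      using rising_coeff_sums sums_summable by blast
    then show ?thesis
      by (rule powser_insidea) (use r in simp)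
  qed
  have "(\<lambda>n. gegenbauer a n z) sums ((\<Sum>n. ?f z n) * (\<Sum>n. ?f (cnj z) n))"
    unfolding gegenbauer_def using assms by (intro Cauchy_product_sums sm) auto
  also have "(\<Sum>n. ?f z n) = (1 - z) powr (- of_real a)"
    using rising_coeff_sums[OF assms] by (rule sums_unique[symmetric])
  also have "(\<Sum>n. ?f (cnj z) n) = (1 - cnj z) powr (- of_real a)"
    using rising_coeff_sums[of "cnj z"] assms by (intro sums_unique[symmetric]) auto
  also have "\<dots> = cnj ((1 - z) powr (- of_real a))"
    using nz by (subst cnj_powr) (auto simp: complex_nonpos_Reals_iff)
  also have "(1 - z) powr (- of_real a) * cnj ((1 - z) powr (- of_real a)) =
      of_real ((cmod ((1 - z) powr (- of_real a)))\<^sup>2)"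
    by (rule complex_norm_square[symmetric])
  also have "cmod ((1 - z) powr (- of_real a)) = cmod (1 - z) powr (- a)"
    by (subst norm_powr_real_powr') auto
  also have "(cmod (1 - z) powr (- a))\<^sup>2 = cmod (1 - z) powr (- (2 * a))"
    using nz by (simp add: power2_eq_square flip: powr_add)
  finally show ?thesis
    using sums_Re by fastforce
qed

definition shifted :: "(nat \<Rightarrow> 'b::zero) \<Rightarrow> nat \<Rightarrow> 'b" where
  "shifted u n = (case n of 0 \<Rightarrow> 0 | Suc k \<Rightarrow> u k)"

text \<open>
  Multiplying the generating function by \<open>1 - z\<close> replaces the first family of coefficients
  by its differences, which lie between \<open>0\<close> and the original coefficients since \<open>1 \<le> a\<close>. So all
  coefficients stay nonnegative, and the norm is at most the value at \<open>\<bar>z\<bar>\<close> without the subtraction.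
\<close>

lemma norm_gegenbauer_diff_le:
  assumes "1 \<le> a"
  shows "cmod (gegenbauer a n z - z * shifted (\<lambda>k. gegenbauer a k z) n) \<le>
    rising_coeff (2 * a) n * cmod z ^ n"
proof -
  let ?r = "rising_coeff a"
  let ?d = "\<lambda>i. ?r i - shifted ?r i"
  have d: "0 \<le> ?d i" "?d i \<le> ?r i" for i
    using rising_coeff_Suc_ge[OF assms] rising_coeff_nonneg[of a] assms
    by (cases i; simp add: shifted_def)+
  have "z * shifted (\<lambda>k. gegenbauer a k z) n =
    (\<Sum>i\<le>n. (of_real (shifted ?r i) * z ^ i) * (of_real (?r (n - i)) * cnj z ^ (n - i)))"
  proof (cases n)
    case (Suc k)
    show ?thesis
      unfolding Suc sum.atMost_Suc_shift
      by (simp add: shifted_def gegenbauer_def sum_distrib_left mult_ac)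
  qed (simp add: shifted_def)
  then have "gegenbauer a n z - z * shifted (\<lambda>k. gegenbauer a k z) n =
     (\<Sum>i\<le>n. of_real (?d i * ?r (n - i)) * (z ^ i * cnj z ^ (n - i)))"
    by (simp add: gegenbauer_def algebra_simps flip: sum_subtractf)
  also have "cmod \<dots> \<le> (\<Sum>i\<le>n. ?r i * ?r (n - i) * cmod z ^ n)"
  proof (rule sum_norm_le)
    fix i assume i: "i \<in> {..n}"
    have "cmod (of_real (?d i * ?r (n - i)) * (z ^ i * cnj z ^ (n - i))) =
        \<bar>?d i * ?r (n - i)\<bar> * (cmod z ^ i * cmod z ^ (n - i))"
      by (simp only: norm_mult norm_of_real norm_power complex_mod_cnj)
    also have "cmod z ^ i * cmod z ^ (n - i) = cmod z ^ n"
      using i by (simp flip: power_add)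
    also have "\<bar>?d i * ?r (n - i)\<bar> = ?d i * ?r (n - i)"
      using d(1)[of i] rising_coeff_nonneg[of a] assms by simp
    also have "?d i * ?r (n - i) * cmod z ^ n \<le> ?r i * ?r (n - i) * cmod z ^ n"
      using d(2)[of i] rising_coeff_nonneg[of a] assms by (intro mult_right_mono) auto
    finally show "cmod (of_real (?d i * ?r (n - i)) * (z ^ i * cnj z ^ (n - i))) \<le>
        ?r i * ?r (n - i) * cmod z ^ n" .
  qed
  also have "\<dots> = rising_coeff (2 * a) n * cmod z ^ n"
    using rising_coeff_convolution[of a a n] by (simp flip: sum_distrib_right)
  finally show ?thesis .
qed

text \<open>
  The plane spanned by \<open>x\<close> and \<open>y\<close> is mapped isometrically, up to the factor \<open>\<bar>y\<bar>\<close>, to the complex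
  plane with \<open>y \<mapsto> 1\<close> and \<open>x \<mapsto> - z\<close>. The sign makes \<open>\<bar>y + x\<bar>\<close> correspond to \<open>\<bar>1 - z\<bar>\<close>.
\<close>

lemma obtain_plane_coordinate:
  fixes x y :: "'b::real_inner"
  assumes "y \<noteq> 0"
  obtains z where "cmod z = norm x / norm y"
    and "\<And>\<alpha> \<beta>. norm (\<alpha> *\<^sub>R y + \<beta> *\<^sub>R x) = norm y * cmod (of_real \<alpha> - of_real \<beta> * z)"
proof -
  let ?p = "(x \<bullet> y) / (norm y)\<^sup>2"
  define z where "z = Complex (- ?p) (sqrt ((norm x / norm y)\<^sup>2 - ?p\<^sup>2))"
  have "\<bar>x \<bullet> y\<bar>\<^sup>2 \<le> (norm x * norm y)\<^sup>2"
    by (intro power_mono Cauchy_Schwarz_ineq2) simp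
  then have "?p\<^sup>2 \<le> (norm x * norm y)\<^sup>2 / ((norm y)\<^sup>2)\<^sup>2"
    by (simp add: power_divide divide_right_mono)
  also have "\<dots> = (norm x / norm y)\<^sup>2"
    using assms by (simp add: power_divide power_mult_distrib power2_eq_square)
  finally have Im: "(Im z)\<^sup>2 = (norm x / norm y)\<^sup>2 - ?p\<^sup>2" and Re: "Re z = - ?p"
    by (simp_all add: z_def)
  have "(cmod z)\<^sup>2 = (norm x / norm y)\<^sup>2"
    unfolding cmod_power2 Im Re by simp
  then have z: "cmod z = norm x / norm y"
    by simp
  have plane: "norm (\<alpha> *\<^sub>R y + \<beta> *\<^sub>R x) = norm y * cmod (of_real \<alpha> - of_real \<beta> * z)" for \<alpha> \<beta>
  proof -
  have "(norm (\<alpha> *\<^sub>R y + \<beta> *\<^sub>R x))\<^sup>2 = \<alpha>\<^sup>2 * (norm y)\<^sup>2 + 2 * \<alpha> * \<beta> * (x \<bullet> y) + \<beta>\<^sup>2 * (norm x)\<^sup>2"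
    unfolding power2_norm_eq_inner
    by (simp add: inner_add_left inner_add_right inner_commute[of y x] power2_eq_square algebra_simps)
  also have "\<dots> = (norm y)\<^sup>2 * (\<alpha>\<^sup>2 + 2 * \<alpha> * \<beta> * ?p + \<beta>\<^sup>2 * (norm x / norm y)\<^sup>2)"
    using assms by (simp add: distrib_left power_divide)
  also have "\<alpha>\<^sup>2 + 2 * \<alpha> * \<beta> * ?p + \<beta>\<^sup>2 * (norm x / norm y)\<^sup>2 =
      (\<alpha> + \<beta> * ?p)\<^sup>2 + \<beta>\<^sup>2 * ((norm x / norm y)\<^sup>2 - ?p\<^sup>2)"
    by (simp only: power2_sum power_mult_distrib right_diff_distrib)
  also have "(\<alpha> + \<beta> * ?p)\<^sup>2 + \<beta>\<^sup>2 * ((norm x / norm y)\<^sup>2 - ?p\<^sup>2) =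
      (cmod (of_real \<alpha> - of_real \<beta> * z))\<^sup>2"
    unfolding cmod_power2 Im[symmetric] by (simp add: Re power_mult_distrib)
  finally have "(norm (\<alpha> *\<^sub>R y + \<beta> *\<^sub>R x))\<^sup>2 = (norm y * cmod (of_real \<alpha> - of_real \<beta> * z))\<^sup>2"
    by (simp add: power_mult_distrib)
  then show ?thesis
    by simp
  qed
  show ?thesis
    using that[OF z plane] .
qed

section \<open>Taylor expansion of the Cauchy kernel\<close>

lemma power_series_coeff_eq_deriv:
  fixes \<psi> :: "nat \<Rightarrow> real \<Rightarrow> real"
  assumes "\<And>n t. \<bar>t\<bar> < 1 \<Longrightarrow> (\<psi> n has_real_derivative \<psi> (Suc n) t) (at t)"
    and "\<And>t. \<bar>t\<bar> < 1 \<Longrightarrow> (\<lambda>n. b n * t ^ n) sums \<psi> 0 t"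
  shows "\<psi> n 0 = fact n * b n"
  using assms
proof (induction n arbitrary: \<psi> b)
  case 0
  from 0(2)[of 0] show ?case
    by simp
next
  case (Suc n)
  have sm: "summable (\<lambda>n. b n * t ^ n)" if "norm t < 1" for t
    using Suc.prems(2)[of t] that by (auto simp: sums_iff)
  have "(\<lambda>n. diffs b n * t ^ n) sums \<psi> (Suc 0) t" if t: "\<bar>t\<bar> < 1" for t
  proof -
    have "((\<lambda>t. \<Sum>n. b n * t ^ n) has_real_derivative (\<Sum>n. diffs b n * t ^ n)) (at t)"
      using termdiffs_strong'[of 1 b t] sm t by simp
    moreover have "((\<lambda>t. \<Sum>n. b n * t ^ n) has_real_derivative \<psi> (Suc 0) t) (at t)"
      by (rule has_field_derivative_transform_within_open[OF Suc.prems(1)[OF t],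
            of "{-1<..<1}"])
        (use t Suc.prems(2) in \<open>auto simp: sums_iff\<close>)
    ultimately have "(\<Sum>n. diffs b n * t ^ n) = \<psi> (Suc 0) t"
      by (rule DERIV_unique)
    moreover have "summable (\<lambda>n. diffs b n * t ^ n)"
      by (rule termdiff_converges[of _ 1]) (use t sm in auto)
    ultimately show ?thesis
      by (simp add: sums_iff)
  qed
  then have "\<psi> (Suc n) 0 = fact n * diffs b n"
    using Suc.IH[of "\<lambda>n. \<psi> (Suc n)" "diffs b"] Suc.prems(1) by blast
  then show ?case
    by (simp add: diffs_def mult_ac)
qed

text \<open>
  This identifies the terms of a series found by other means with iterated derivatives, without
  differentiating that series term by term in the space variables.
\<close>

lemma vector_power_series_coeff_eq_deriv:
  fixes \<phi> :: "nat \<Rightarrow> real \<Rightarrow> 'b::euclidean_space"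
  assumes "\<And>n t. \<bar>t\<bar> < 1 \<Longrightarrow> (\<phi> n has_vector_derivative \<phi> (Suc n) t) (at t)"
    and "\<And>t. \<bar>t\<bar> < 1 \<Longrightarrow> (\<lambda>n. t ^ n *\<^sub>R a n) sums \<phi> 0 t"
  shows "\<phi> n 0 = fact n *\<^sub>R a n"
proof (rule euclidean_eqI)
  fix e :: 'b
  have "((\<lambda>t. \<phi> n t \<bullet> e) has_real_derivative \<phi> (Suc n) t \<bullet> e) (at t)" if "\<bar>t\<bar> < 1" for n t
    unfolding has_real_derivative_iff_has_vector_derivative
    using bounded_linear.has_vector_derivative[OF bounded_linear_inner_left assms(1)[OF that]] .
  moreover have "(\<lambda>n. (a n \<bullet> e) * t ^ n) sums (\<phi> 0 t \<bullet> e)" if "\<bar>t\<bar> < 1" for t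
    using bounded_linear.sums[OF bounded_linear_inner_left assms(2)[OF that], of e]
    by (simp add: mult.commute)
  ultimately show "\<phi> n 0 \<bullet> e = (fact n *\<^sub>R a n) \<bullet> e"
    using power_series_coeff_eq_deriv[of "\<lambda>n t. \<phi> n t \<bullet> e" "\<lambda>n. a n \<bullet> e" n] by simp
qed

context hypercomplex
begin

definition taylor_term :: "nat \<Rightarrow> 'a \<Rightarrow> 'a \<Rightarrow> 'a" where
  "taylor_term n x y = (1 / fact n) *\<^sub>R
     word_sum {..m} (\<lambda>s. of_real (coord x s)) (\<lambda>B. kernel_diff B y) n {#}"

lemma word_sum_kernel_diff_has_vector_derivative:
  assumes xy: "x \<in> M" "y \<in> M" and nz: "y + t *\<^sub>R x \<noteq> 0" and B: "set_mset B \<subseteq> {..m}"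
  shows "((\<lambda>t. word_sum {..m} (\<lambda>s. of_real (coord x s)) (\<lambda>B. kernel_diff B (y + t *\<^sub>R x)) n B)
    has_vector_derivative
    word_sum {..m} (\<lambda>s. of_real (coord x s)) (\<lambda>B. kernel_diff B (y + t *\<^sub>R x)) (Suc n) B) (at t)"
  using B
proof (induction n arbitrary: B)
  case 0
  then show ?case
    using kernel_diff_has_vector_derivative[OF _ xy nz, of B]
    by (simp add: scaleR_conv_of_real)
next
  case (Suc n)
  have "((\<lambda>t. \<Sum>s\<le>m. coord x s *\<^sub>R word_sum {..m} (\<lambda>s. of_real (coord x s))
        (\<lambda>B. kernel_diff B (y + t *\<^sub>R x)) n (add_mset s B)) has_vector_derivative
      (\<Sum>s\<le>m. coord x s *\<^sub>R word_sum {..m} (\<lambda>s. of_real (coord x s))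
        (\<lambda>B. kernel_diff B (y + t *\<^sub>R x)) (Suc n) (add_mset s B))) (at t)"
    by (intro has_vector_derivative_sum
        bounded_linear.has_vector_derivative[OF bounded_linear_scaleR_right] Suc.IH)
      (use Suc.prems in auto)
  then show ?case
    by (simp add: scaleR_conv_of_real)
qed

text \<open>
  Along the segment from \<open>y\<close> to \<open>y + x\<close> the kernel is a power series in the parameter \<open>t\<close>, namely
  \<open>c (y + t x) / \<bar>y\<bar>\<^sup>m\<^sup>+\<^sup>1\<close> times the Gegenbauer series with \<open>a = (m + 1) / 2\<close> at \<open>t z\<close>. Its terms are
  the Taylor terms by uniqueness of coefficients. Since \<open>c\<close> is isometric on \<open>M\<close>, the norm of a
  term is that of a real combination of \<open>x\<close> and \<open>y\<close>, which the plane coordinate turns into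
  the difference estimated in \<open>norm_gegenbauer_diff_le\<close>.
\<close>

lemma kernel_taylor:
  assumes xy: "x \<in> M" "y \<in> M" and less: "norm x < norm y"
  shows "(\<lambda>n. taylor_term n x y) sums kernel_diff {#} (y + x)"
    and "norm (taylor_term n x y) \<le> real ((n + m) choose m) * norm x ^ n / norm y ^ (m + n)"
proof -
  let ?a = "(real m + 1) / 2"
  have m: "1 \<le> m"
    using basis by (simp add: hypercomplex_basis_def)
  have y: "y \<noteq> 0"
    using less by auto
  obtain z where z: "cmod z = norm x / norm y"
    and plane: "\<And>\<alpha> \<beta>. norm (\<alpha> *\<^sub>R y + \<beta> *\<^sub>R x) = norm y * cmod (of_real \<alpha> - of_real \<beta> * z)"
    using obtain_plane_coordinate[OF y] by blast
  define u where "u n = Re (gegenbauer ?a n z)" for n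
  \<comment> \<open>The factor \<open>y + t x\<close> contributes to degree \<open>n\<close> through \<open>u n\<close> and the shifted \<open>u (n - 1)\<close>.\<close>
  define f where "f n = (1 / norm y ^ (m + 1)) *\<^sub>R c (u n *\<^sub>R y + shifted u n *\<^sub>R x)" for n
  have lt: "norm (t *\<^sub>R x) < norm y" if "\<bar>t\<bar> \<le> 1" for t
    using less mult_right_mono[OF that, of "norm x"] by simp
  have nz: "y + t *\<^sub>R x \<noteq> 0" if "\<bar>t\<bar> \<le> 1" for t
    using lt[OF that] by (metis add_eq_0_iff less_irrefl norm_minus_cancel)
  have sums: "(\<lambda>n. t ^ n *\<^sub>R f n) sums kernel_diff {#} (y + t *\<^sub>R x)" if t: "\<bar>t\<bar> \<le> 1" for t
  proof -
    let ?S = "1 / cmod (1 - of_real t * z) ^ (m + 1)"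
    have "cmod (of_real t * z) < 1"
      using lt[OF t] y by (simp add: norm_mult z)
    then have "(\<lambda>n. Re (gegenbauer ?a n (of_real t * z))) sums
        (cmod (1 - of_real t * z) powr (- (2 * ?a)))"
      by (rule gegenbauer_sums)
    moreover have "Re (gegenbauer ?a n (of_real t * z)) = t ^ n * u n" for n
      unfolding gegenbauer_scale u_def by (subst gegenbauer_real) simp
    moreover have "cmod (1 - of_real t * z) powr (- (2 * ?a)) = ?S"
    proof -
      have "cmod (1 - of_real t * z) \<noteq> 0"
        using plane[of 1 t] nz[OF t] by auto
      then have pos: "0 < cmod (1 - of_real t * z)"
        by simp
      have "cmod (1 - of_real t * z) powr (- real (m + 1)) = ?S"
        using pos by (subst powr_minus_divide) (simp only: powr_realpow)
      moreover have "2 * ?a = real (m + 1)"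
        by simp
      ultimately show ?thesis
        by (simp only:)
    qed
    ultimately have S: "(\<lambda>n. t ^ n * u n) sums ?S"
      by simp
    have "(\<lambda>n. t * (t ^ n * u n)) sums (t * ?S)"
      by (intro sums_mult S)
    then have "(\<lambda>n. t ^ Suc n * shifted u (Suc n)) sums (t * ?S)"
      by (simp add: shifted_def mult.assoc)
    then have S': "(\<lambda>n. t ^ n * shifted u n) sums (t * ?S)"
      by (subst (asm) sums_Suc_iff) (simp add: shifted_def)
    have "(\<lambda>n. (t ^ n * u n) *\<^sub>R y + (t ^ n * shifted u n) *\<^sub>R x) sums (?S *\<^sub>R y + (t * ?S) *\<^sub>R x)"
      by (rule sums_add[OF sums_scaleR_left[OF S] sums_scaleR_left[OF S']])
    then have "(\<lambda>n. c ((t ^ n * u n) *\<^sub>R y + (t ^ n * shifted u n) *\<^sub>R x)) sums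
        c (?S *\<^sub>R y + (t * ?S) *\<^sub>R x)"
      by (rule bounded_linear.sums[rotated]) (use linear_c in \<open>simp add: linear_conv_bounded_linear\<close>)
    then have "(\<lambda>n. (1 / norm y ^ (m + 1)) *\<^sub>R c ((t ^ n * u n) *\<^sub>R y + (t ^ n * shifted u n) *\<^sub>R x)) sums
        ((1 / norm y ^ (m + 1)) *\<^sub>R c (?S *\<^sub>R y + (t * ?S) *\<^sub>R x))"
      by (rule sums_scaleR_right)
    moreover have "(1 / norm y ^ (m + 1)) *\<^sub>R
        c ((t ^ n * u n) *\<^sub>R y + (t ^ n * shifted u n) *\<^sub>R x) = t ^ n *\<^sub>R f n" for n
    proof -
      have "(t ^ n * u n) *\<^sub>R y + (t ^ n * shifted u n) *\<^sub>R x =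
          t ^ n *\<^sub>R (u n *\<^sub>R y + shifted u n *\<^sub>R x)"
        by (simp add: scaleR_right_distrib)
      then show ?thesis
        by (simp only: f_def linear_scale[OF linear_c] scaleR_scaleR mult.commute)
    qed
    moreover have "(1 / norm y ^ (m + 1)) *\<^sub>R c (?S *\<^sub>R y + (t * ?S) *\<^sub>R x) =
        kernel_diff {#} (y + t *\<^sub>R x)"
    proof -
      have "?S *\<^sub>R y + (t * ?S) *\<^sub>R x = ?S *\<^sub>R (y + t *\<^sub>R x)"
        by (simp add: scaleR_right_distrib mult.commute)
      moreover have "y + t *\<^sub>R x \<in> M"
        using xy by (intro subspace_add subspace_scale subspace_M)
      moreover have "norm (y + t *\<^sub>R x) = norm y * cmod (1 - of_real t * z)"
        using plane[of 1 t] by simp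
      ultimately show ?thesis
        by (simp only: kernel_diff_empty linear_scale[OF linear_c] power_mult_distrib scaleR_scaleR)
          (simp only: divide_inverse inverse_mult_distrib mult_1_left mult.commute)
    qed
    ultimately show ?thesis
      by (simp only:)
  qed
  \<comment> \<open>Only \<open>\<bar>t\<bar> < 1\<close> enters the identification of the terms; \<open>t = 1\<close> is used for the sum itself.\<close>
  let ?\<phi> = "\<lambda>n t. word_sum {..m} (\<lambda>s. of_real (coord x s)) (\<lambda>B. kernel_diff B (y + t *\<^sub>R x)) n {#}"
  have "?\<phi> n 0 = fact n *\<^sub>R f n" for n
  proof (rule vector_power_series_coeff_eq_deriv)
    show "(?\<phi> n has_vector_derivative ?\<phi> (Suc n) t) (at t)" if "\<bar>t\<bar> < 1" for n t
      by (rule word_sum_kernel_diff_has_vector_derivative) (use xy nz[of t] that in auto)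
    show "(\<lambda>n. t ^ n *\<^sub>R f n) sums ?\<phi> 0 t" if "\<bar>t\<bar> < 1" for t
      using sums[of t] that by simp
  qed
  then have f: "taylor_term n x y = f n" for n
    by (simp add: taylor_term_def)
  show "(\<lambda>n. taylor_term n x y) sums kernel_diff {#} (y + x)"
    using sums[of 1] by (simp add: f)
  have "u n *\<^sub>R y + shifted u n *\<^sub>R x \<in> M"
    using xy by (intro subspace_add subspace_scale subspace_M)
  then have "norm (f n) = norm (u n *\<^sub>R y + shifted u n *\<^sub>R x) / norm y ^ (m + 1)"
    by (simp add: f_def norm_c)
  also have "norm (u n *\<^sub>R y + shifted u n *\<^sub>R x) =
      norm y * cmod (gegenbauer ?a n z - z * shifted (\<lambda>k. gegenbauer ?a k z) n)"
  proof -
    have "of_real (u n) = gegenbauer ?a n z"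
      unfolding u_def by (rule gegenbauer_real[symmetric])
    moreover have "of_real (shifted u n) = shifted (\<lambda>k. gegenbauer ?a k z) n"
      by (cases n) (simp_all add: shifted_def u_def flip: gegenbauer_real)
    ultimately show ?thesis
      by (simp add: plane mult.commute)
  qed
  also have "\<dots> \<le> norm y * (rising_coeff (2 * ?a) n * cmod z ^ n)"
    using m by (intro mult_left_mono norm_gegenbauer_diff_le) auto
  also have "2 * ?a = real m + 1"
    by simp
  also have "rising_coeff (real m + 1) n = real ((n + m) choose m)"
    by (rule rising_coeff_Suc_nat)
  also have "norm y * (real ((n + m) choose m) * cmod z ^ n) / norm y ^ (m + 1) =
      real ((n + m) choose m) * norm x ^ n / norm y ^ (m + n)"
    using y by (simp add: z power_divide power_add)
  finally show "norm (taylor_term n x y) \<le> real ((n + m) choose m) * norm x ^ n / norm y ^ (m + n)"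
    unfolding f by (simp add: divide_right_mono)
qed

end

section \<open>Power series in several variables\<close>

text \<open>
  A linear substitution of variables \<open>z\<^sub>j = \<Sum> e\<^sub>i w\<^sub>i\<close>, the sum running over the \<open>i\<close> with \<open>\<sigma> i = j\<close>. It is
  applied to \<open>z = - x\<close>, and to the increment of \<open>y - x\<close> in terms of those of \<open>x\<close> and \<open>y\<close>.
\<close>

lemma word_sum_map:
  fixes G :: "'j multiset \<Rightarrow> 'a::real_algebra_1"
  assumes "\<And>H :: 'j \<Rightarrow> 'a. (\<Sum>j\<in>J. z j *\<^sub>R H j) = (\<Sum>i\<in>I. (e i * w i) *\<^sub>R H (\<sigma> i))"
  shows "word_sum I (\<lambda>i. of_real (w i))
      (\<lambda>C. prod_mset (image_mset e C) *\<^sub>R G (image_mset \<sigma> C)) n C =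
    prod_mset (image_mset e C) *\<^sub>R word_sum J (\<lambda>j. of_real (z j)) G n (image_mset \<sigma> C)"
proof (induction n arbitrary: C)
  case (Suc n)
  then show ?case
    by (simp add: assms scaleR_sum_right mult_ac flip: scaleR_conv_of_real)
qed simp

lemma word_sum_power:
  assumes "finite I"
  shows "word_sum I (\<lambda>i. of_real (w i)) G n {#} =
    (\<Sum>k\<in>multi_indices_deg I n. (fact n / multi_fact I k * (\<Prod>i\<in>I. w i ^ k i)) *\<^sub>R
      (G (Abs_multiset k) :: 'a::real_algebra_1))"
proof -
  let ?Q = "\<lambda>k. of_real (\<Prod>i\<in>I. w i ^ k i) :: 'a"
  have "real (Suc n) *\<^sub>R ?Q k =
      (\<Sum>s\<in>I. if k s = 0 then 0 else real (k s) *\<^sub>R (?Q (k(s := k s - 1)) * of_real (w s)))"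
    if k: "k \<in> multi_indices_deg I (Suc n)" for n k
  proof -
    have "(if k s = 0 then 0 else real (k s) *\<^sub>R (?Q (k(s := k s - 1)) * of_real (w s))) =
        real (k s) *\<^sub>R ?Q k" if "s \<in> I" for s
    proof (cases "k s = 0")
      case False
      then have "k = (k(s := k s - 1))(s := Suc ((k(s := k s - 1)) s))"
        by auto
      then have "(\<Prod>i\<in>I. w i ^ k i) = w s * (\<Prod>i\<in>I. w i ^ (k(s := k s - 1)) i)"
        using prod_power_Suc[OF assms that, of w "k(s := k s - 1)"] by simp
      then have "?Q (k(s := k s - 1)) * of_real (w s) = ?Q k"
        by (metis mult.commute of_real_mult)
      then show ?thesis
        using False by (simp only: if_False)
    qed simp
    moreover have "(\<Sum>s\<in>I. real (k s)) = real (Suc n)"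
      using k by (simp add: multi_indices_deg_def flip: of_nat_sum)
    ultimately show ?thesis
      by (simp flip: scaleR_sum_left)
  qed
  then have "word_sum I (\<lambda>i. of_real (w i)) G (0 + n) {#} =
      (\<Sum>k\<in>multi_indices_deg I n. (fact n / multi_fact I k) *\<^sub>R
        (?Q k * word_sum I (\<lambda>i. of_real (w i)) G 0 (Abs_multiset k)))"
    by (intro word_sum_expand assms) auto
  then show ?thesis
    by (simp flip: scaleR_conv_of_real)
qed

lemma multinomial_sum:
  assumes "finite I"
  shows "(\<Sum>k\<in>multi_indices_deg I n. fact n / multi_fact I k) = real (card I) ^ n"
proof -
  have "word_sum I (\<lambda>_. of_real 1) (\<lambda>_. 1) n B = real (card I) ^ n" for B
    by (induction n arbitrary: B) auto
  from this[of "{#}"] show ?thesis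
    unfolding word_sum_power[OF assms] by simp
qed

text \<open>
  A bound \<open>C\<^sup>n n!\<close> on the derivatives of order \<open>n\<close> makes the multi-index series absolutely
  summable on a small cube, because the multinomial coefficients of degree \<open>n\<close> add up to
  \<open>card I ^ n\<close>. Absolute summability permits regrouping by degree, which recovers the
  given series of homogeneous terms.
\<close>

lemma has_sum_multi_indices:
  fixes G :: "'i multiset \<Rightarrow> 'a::{euclidean_space, real_algebra_1}"
  assumes I: "finite I"
    and bound: "\<And>C. set_mset C \<subseteq> I \<Longrightarrow> norm (G C) \<le> K * D ^ size C * fact (size C)"
    and pos: "0 \<le> K" "0 \<le> D" "0 \<le> r" and small: "D * r * real (card I) < 1"
    and w: "\<And>i. i \<in> I \<Longrightarrow> \<bar>w i\<bar> \<le> r"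
    and sums: "(\<lambda>n. (1 / fact n) *\<^sub>R word_sum I (\<lambda>i. of_real (w i)) G n {#}) sums S"
  shows "((\<lambda>k. (\<Prod>i\<in>I. w i ^ k i) *\<^sub>R ((1 / multi_fact I k) *\<^sub>R G (Abs_multiset k))) has_sum S)
    (multi_indices I)"
proof -
  let ?f = "\<lambda>k. (\<Prod>i\<in>I. w i ^ k i) *\<^sub>R ((1 / multi_fact I k) *\<^sub>R G (Abs_multiset k))"
  let ?T = "SIGMA n:UNIV. multi_indices_deg I n"
  have degree_sum: "(\<Sum>k\<in>multi_indices_deg I n. ?f k) =
      (1 / fact n) *\<^sub>R word_sum I (\<lambda>i. of_real (w i)) G n {#}" for n
    unfolding word_sum_power[OF I] scaleR_sum_right by (intro sum.cong refl) simp
  have norm_sum: "(\<Sum>k\<in>multi_indices_deg I n. norm (?f k)) \<le> K * (D * r * real (card I)) ^ n" for n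
  proof -
    have "(\<Sum>k\<in>multi_indices_deg I n. norm (?f k)) \<le>
        (\<Sum>k\<in>multi_indices_deg I n. K * (D * r) ^ n * (fact n / multi_fact I k))"
    proof (rule sum_mono)
      fix k assume k: "k \<in> multi_indices_deg I n"
      have "\<bar>\<Prod>i\<in>I. w i ^ k i\<bar> = (\<Prod>i\<in>I. \<bar>w i\<bar> ^ k i)"
        by (simp add: abs_prod power_abs)
      also have "\<dots> \<le> (\<Prod>i\<in>I. r ^ k i)"
        using w by (intro prod_mono conjI power_mono) auto
      also have "\<dots> = r ^ n"
        using k by (simp add: power_sum[symmetric] multi_indices_deg_def)
      finally have 1: "\<bar>\<Prod>i\<in>I. w i ^ k i\<bar> \<le> r ^ n" .
      have 2: "norm (G (Abs_multiset k)) \<le> K * D ^ n * fact n"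
        using bound[of "Abs_multiset k"] Abs_multiset_deg[OF I k] by simp
      have "norm (?f k) = \<bar>\<Prod>i\<in>I. w i ^ k i\<bar> * norm (G (Abs_multiset k)) / multi_fact I k"
        using multi_fact_pos[of I k] by simp
      also have "\<dots> \<le> r ^ n * (K * D ^ n * fact n) / multi_fact I k"
        using multi_fact_pos[of I k] pos by (intro divide_right_mono mult_mono 1 2) auto
      finally show "norm (?f k) \<le> K * (D * r) ^ n * (fact n / multi_fact I k)"
        by (simp add: power_mult_distrib mult_ac)
    qed
    also have "\<dots> = K * (D * r * real (card I)) ^ n"
      unfolding sum_distrib_left[symmetric] multinomial_sum[OF I]
      by (simp add: power_mult_distrib mult.assoc)
    finally show ?thesis .
  qed
  have fin: "finite (multi_indices_deg I n)" for n
    by (rule finite_multi_indices_deg[OF I])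
  have "summable (\<lambda>n. K * (D * r * real (card I)) ^ n)"
    using pos small by (intro summable_mult summable_geometric) simp
  then have "summable (\<lambda>n. \<Sum>k\<in>multi_indices_deg I n. norm (?f k))"
    by (rule summable_comparison_test'[where N = 0]) (use norm_sum in \<open>simp add: sum_nonneg\<close>)
  then have "(\<lambda>n. norm (\<Sum>k\<in>multi_indices_deg I n. norm (?f k))) summable_on UNIV"
    by (simp add: summable_on_UNIV_nonneg_real_iff sum_nonneg)
  then have "(\<lambda>z. norm (case z of (n, k) \<Rightarrow> ?f k)) summable_on ?T"
    by (subst Infinite_Sum.abs_summable_on_Sigma_iff) (simp add: fin)
  then have "(\<lambda>(n, k). ?f k) summable_on ?T"
    by (rule abs_summable_summable)
  then obtain S' where S': "((\<lambda>(n, k). ?f k) has_sum S') ?T"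
    by (auto simp: summable_on_def)
  have "((\<lambda>n. \<Sum>k\<in>multi_indices_deg I n. ?f k) has_sum S') UNIV"
    by (rule has_sum_SigmaD[OF S']) (simp add: fin has_sum_finite)
  then have "S' = S"
    using has_sum_imp_sums sums sums_unique2 unfolding degree_sum by blast
  have "bij_betw snd ?T (multi_indices I)"
    by (rule bij_betw_byWitness[of _ "\<lambda>k. (\<Sum>i\<in>I. k i, k)"])
      (auto simp: multi_indices_deg_def)
  then show ?thesis
    using S' \<open>S' = S\<close> by (simp add: has_sum_reindex_bij_betw[symmetric] case_prod_unfold)
qed

section \<open>Expansion into Fueter polynomials\<close>

lemma fueter_poly_recursion:
  assumes "k \<in> multi_indices_deg {1..m} (Suc n)"
  shows "real (Suc n) *\<^sub>R fueter_poly v m (\<lambda>s. int (k s)) x =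
    (\<Sum>s\<in>{1..m}. if k s = 0 then 0 else real (k s) *\<^sub>R
      (fueter_poly v m (\<lambda>u. int ((k(s := k s - 1)) u)) x * fueter_var v s x))"
proof -
  have sum: "(\<Sum>s=1..m. k s) = Suc n"
    using assms by (simp add: multi_indices_deg_def)
  then have "(\<Sum>s=1..m. int (k s)) = int (Suc n)"
    by (metis of_nat_sum)
  moreover have "\<not> (\<forall>s\<in>{1..m}. int (k s) = 0)"
  proof
    assume "\<forall>s\<in>{1..m}. int (k s) = 0"
    then have "(\<Sum>s=1..m. k s) = 0"
      by simp
    with sum show False
      by simp
  qed
  ultimately have "real (Suc n) *\<^sub>R fueter_poly v m (\<lambda>s. int (k s)) x =
    (\<Sum>s=1..m. real (k s) *\<^sub>R
      (fueter_poly v m ((\<lambda>s. int (k s))(s := int (k s) - 1)) x * fueter_var v s x))"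
    by (subst fueter_poly.simps) (simp del: of_nat_Suc)
  also have "\<dots> = (\<Sum>s\<in>{1..m}. if k s = 0 then 0 else real (k s) *\<^sub>R
      (fueter_poly v m (\<lambda>u. int ((k(s := k s - 1)) u)) x * fueter_var v s x))"
  proof (intro sum.cong refl)
    fix s
    show "real (k s) *\<^sub>R
        (fueter_poly v m ((\<lambda>s. int (k s))(s := int (k s) - 1)) x * fueter_var v s x) =
        (if k s = 0 then 0 else real (k s) *\<^sub>R
          (fueter_poly v m (\<lambda>u. int ((k(s := k s - 1)) u)) x * fueter_var v s x))"
    proof (cases "k s = 0")
      case False
      then have "(\<lambda>u. int ((k(s := k s - 1)) u)) = (\<lambda>s. int (k s))(s := int (k s) - 1)"
        by (auto simp: fun_eq_iff)
      then show ?thesis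
        using False by (simp only: if_False)
    qed simp
  qed
  finally show ?thesis .
qed

lemma fueter_poly_0: "fueter_poly v m (\<lambda>_. 0) x = 1"
  by (subst fueter_poly.simps) simp

text \<open>
  The norm of the algebra need not be submultiplicative; continuity of the product comes from
  finite dimension.
\<close>

lemma bounded_bilinear_times:
  "bounded_bilinear ((*) :: 'a \<Rightarrow> 'a \<Rightarrow> 'a::{euclidean_space, real_algebra_1})"
  unfolding bilinear_conv_bounded_bilinear[symmetric] bilinear_def
  by (auto intro!: linearI simp: algebra_simps)

lemma continuous_on_fueter_poly:
  fixes v :: "nat \<Rightarrow> 'a::{euclidean_space, real_algebra_1}"
  assumes "k \<in> multi_indices_deg {1..m} n"
  shows "continuous_on S (fueter_poly v m (\<lambda>s. int (k s)))"
  using assms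
proof (induction n arbitrary: k)
  case 0
  then show ?case
    by (simp add: multi_indices_deg_0 fueter_poly_0)
next
  case (Suc n)
  have var: "continuous_on S (fueter_var v s)" for s
    unfolding fueter_var_def by (intro continuous_intros)
  have "fueter_poly v m (\<lambda>s. int (k s)) = (\<lambda>x. (1 / real (Suc n)) *\<^sub>R
      (\<Sum>s\<in>{1..m}. if k s = 0 then 0 else real (k s) *\<^sub>R
      (fueter_poly v m (\<lambda>u. int ((k(s := k s - 1)) u)) x * fueter_var v s x)))"
    by (rule ext) (simp only: fueter_poly_recursion[OF Suc.prems, symmetric], simp)
  moreover have "continuous_on S (\<lambda>x. if k s = 0 then 0 else real (k s) *\<^sub>R
      (fueter_poly v m (\<lambda>u. int ((k(s := k s - 1)) u)) x * fueter_var v s x))"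
    if "s \<in> {1..m}" for s
  proof (cases "k s = 0")
    case False
    have "k(s := k s - 1) \<in> multi_indices_deg {1..m} n"
      by (rule multi_indices_deg_fun_upd_pred[OF _ that Suc.prems False]) simp
    then show ?thesis
      using False by (simp only: if_False)
        (intro continuous_on_scaleR continuous_on_const
          bounded_bilinear.continuous_on[OF bounded_bilinear_times] Suc.IH var)
  qed simp
  ultimately show ?case
    by (simp only:) (intro continuous_on_scaleR continuous_on_const continuous_on_sum)
qed

context hypercomplex
begin

lemma dirac_word_sum:
  assumes "\<And>B. set_mset B \<subseteq> {..m} \<Longrightarrow> (\<Sum>s\<le>m. v s * G (add_mset s B)) = 0"
    and "set_mset B \<subseteq> {..m}"
  shows "(\<Sum>s\<le>m. v s * word_sum {..m} (\<lambda>s. of_real (w s)) G n (add_mset s B)) = 0"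
  using assms(2)
proof (induction n arbitrary: B)
  case 0
  then show ?case
    by (simp add: assms(1))
next
  case (Suc n)
  let ?W = "word_sum {..m} (\<lambda>s. of_real (w s)) G n"
  have "(\<Sum>s\<le>m. v s * word_sum {..m} (\<lambda>s. of_real (w s)) G (Suc n) (add_mset s B)) =
      (\<Sum>s\<le>m. \<Sum>u\<le>m. w u *\<^sub>R (v s * ?W (add_mset s (add_mset u B))))"
    by (simp add: sum_distrib_left add_mset_commute flip: scaleR_conv_of_real)
  also have "\<dots> = (\<Sum>u\<le>m. w u *\<^sub>R (\<Sum>s\<le>m. v s * ?W (add_mset s (add_mset u B))))"
    unfolding scaleR_sum_right by (rule sum.swap)
  also have "\<dots> = 0"
    using Suc by (intro sum.neutral) auto
  finally show ?case .
qed

text \<open>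
  The Dirac equation expresses the term of index \<open>0\<close> through the others:
  \<open>\<Sum>\<^sub>s\<^sub>\<ge>\<^sub>0 x\<^sub>s G\<^sub>s = \<Sum>\<^sub>s\<^sub>\<ge>\<^sub>1 (x\<^sub>s - x\<^sub>0 v\<^sub>s) G\<^sub>s\<close>. It holds for the inner sums as well
  (\<open>dirac_word_sum\<close>), as real coefficients commute with the \<open>v\<^sub>s\<close>, and so the replacement is possible in
  every factor.
\<close>

lemma word_sum_fueter_var:
  assumes dirac: "\<And>B. set_mset B \<subseteq> {..m} \<Longrightarrow> (\<Sum>s\<le>m. v s * G (add_mset s B)) = 0"
    and "set_mset B \<subseteq> {..m}"
  shows "word_sum {..m} (\<lambda>s. of_real (coord x s)) G n B =
    word_sum {1..m} (\<lambda>s. fueter_var v s x) G n B"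
  using assms(2)
proof (induction n arbitrary: B)
  case (Suc n)
  let ?W = "\<lambda>s. word_sum {..m} (\<lambda>s. of_real (coord x s)) G n (add_mset s B)"
  have split: "(\<Sum>s\<le>m. f s) = f 0 + (\<Sum>s\<in>{1..m}. f s)" for f :: "nat \<Rightarrow> 'a"
    by (simp add: atMost_atLeast0 sum.atLeast_Suc_atMost)
  have 0: "?W 0 = - (\<Sum>s\<in>{1..m}. v s * ?W s)"
    using dirac_word_sum[OF dirac Suc.prems, of "coord x" n]
    by (simp add: split v_0 eq_neg_iff_add_eq_0)
  have "word_sum {..m} (\<lambda>s. of_real (coord x s)) G (Suc n) B =
      coord x 0 *\<^sub>R ?W 0 + (\<Sum>s\<in>{1..m}. coord x s *\<^sub>R ?W s)"
    by (simp add: split flip: scaleR_conv_of_real)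
  also have "\<dots> = (\<Sum>s\<in>{1..m}. fueter_var v s x * ?W s)"
    unfolding 0
    by (simp add: fueter_var_def coord_def left_diff_distrib sum_subtractf scaleR_sum_right
        flip: scaleR_conv_of_real)
  also have "\<dots> = (\<Sum>s\<in>{1..m}. fueter_var v s x *
      word_sum {1..m} (\<lambda>s. fueter_var v s x) G n (add_mset s B))"
    using Suc by (intro sum.cong refl) auto
  finally show ?case
    by simp
qed simp

text \<open>
  The numerator of \<open>(-1)\<^sup>|\<^sup>k\<^sup>| \<partial>\<^sup>k E / k!\<close> at \<open>y\<close>; the sign is that of the direction \<open>- x\<close>.
\<close>

definition kernel_numerator :: "(nat \<Rightarrow> nat) \<Rightarrow> 'a \<Rightarrow> 'a" where
  "kernel_numerator k y =
     ((- 1) ^ (\<Sum>s=1..m. k s) / multi_fact {1..m} k) *\<^sub>R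
       feval m (Suc (\<Sum>s=1..m. k s)) (kernel_coeffs (Abs_multiset k)) (coord y)"

lemma Abs_multiset_subset:
  "k \<in> multi_indices_deg {1..m} n \<Longrightarrow> set_mset (Abs_multiset k) \<subseteq> {..m}"
  using Abs_multiset_deg(1)[of "{1..m}" k n] by auto

lemma kernel_numerator_in_M:
  "k \<in> multi_indices_deg {1..m} n \<Longrightarrow> kernel_numerator k y \<in> M"
  unfolding kernel_numerator_def
  by (intro subspace_scale subspace_M feval_kernel_coeffs_in_M Abs_multiset_subset)

lemma homogeneous_kernel_numerator:
  assumes "k \<in> multi_indices_deg {1..m} n"
  shows "homogeneous_polynomial_on v m (n + 1) U (kernel_numerator k)"
proof -
  have "(\<Sum>s=1..m. k s) = n"
    using assms by (simp add: multi_indices_deg_def)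
  then show ?thesis
    unfolding homogeneous_polynomial_on_def
    by (intro exI[of _ "\<lambda>\<alpha>. ((- 1) ^ n / multi_fact {1..m} k) *\<^sub>R kernel_coeffs (Abs_multiset k) \<alpha>"])
      (simp add: kernel_numerator_def feval_def coord_def scaleR_sum_right mult.commute)
qed

lemma continuous_on_kernel_numerator: "continuous_on S (kernel_numerator k)"
  unfolding kernel_numerator_def feval_def coord_def by (intro continuous_intros)

text \<open>
  The sign \<open>(-1)\<^sup>n\<close> of the direction \<open>- x\<close> is moved into the derivatives, so that the Fueter variables
  are those of \<open>x\<close>. Then the words are replaced by words in the Fueter variables and collected.
\<close>

lemma taylor_term_eq_kernel_term:
  "taylor_term n (- x) y = kernel_term v m kernel_numerator n (x, y)"
proof -
  define G where "G B = (- 1) ^ size B *\<^sub>R kernel_diff B y" for B :: "nat multiset"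
  have dirac: "(\<Sum>s\<le>m. v s * G (add_mset s B)) = 0" if "set_mset B \<subseteq> {..m}" for B
    using dirac_kernel_diff[OF that, of y] by (simp add: G_def sum_negf flip: scaleR_sum_right)
  have "word_sum {..m} (\<lambda>s. of_real (coord (- x) s)) (\<lambda>B. kernel_diff B y) n {#} =
      word_sum {..m} (\<lambda>s. of_real (coord x s)) G n {#}"
    using word_sum_map[where J = "{..m}" and I = "{..m}" and z = "coord (- x)" and w = "coord x"
        and e = "\<lambda>_. - 1" and \<sigma> = "\<lambda>s. s" and G = "\<lambda>B. kernel_diff B y" and n = n and C = "{#}"]
    by (simp add: coord_def G_def[abs_def] image_mset_const_eq)
  also have "\<dots> = word_sum {1..m} (\<lambda>s. fueter_var v s x) G (0 + n) {#}"
    using word_sum_fueter_var[OF dirac] by simp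
  also have "\<dots> = (\<Sum>k\<in>multi_indices_deg {1..m} n. (fact n / multi_fact {1..m} k) *\<^sub>R
      (fueter_poly v m (\<lambda>s. int (k s)) x * G (Abs_multiset k)))"
    by (subst word_sum_expand[where Q = "\<lambda>k. fueter_poly v m (\<lambda>s. int (k s)) x"])
      (auto simp: fueter_poly_0 fueter_poly_recursion simp del: of_nat_Suc)
  finally have "taylor_term n (- x) y = (\<Sum>k\<in>multi_indices_deg {1..m} n. (1 / multi_fact {1..m} k) *\<^sub>R
      (fueter_poly v m (\<lambda>s. int (k s)) x * G (Abs_multiset k)))"
    by (simp add: taylor_term_def scaleR_sum_right)
  also have "\<dots> = kernel_term v m kernel_numerator n (x, y)"
    unfolding kernel_term_def prod.case
  proof (rule sum.cong[OF refl])
    fix k assume k: "k \<in> multi_indices_deg {1..m} n"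
    then have "(\<Sum>s=1..m. k s) = n" "size (Abs_multiset k) = n"
      using Abs_multiset_deg(2)[OF _ k] by (auto simp: multi_indices_deg_def)
    then show "(1 / multi_fact {1..m} k) *\<^sub>R
        (fueter_poly v m (\<lambda>s. int (k s)) x * G (Abs_multiset k)) =
        fueter_poly v m (\<lambda>s. int (k s)) x *
          ((1 / norm y ^ (m + 2 * n + 1)) *\<^sub>R kernel_numerator k y)"
      by (simp add: G_def kernel_diff_def kernel_numerator_def mult_ac)
  qed
  finally show ?thesis .
qed

lemma cauchy_kernel_eq:
  "w \<in> M \<Longrightarrow> cauchy_kernel c m w = (1 / sphere_const m) *\<^sub>R kernel_diff {#} w"
  by (simp add: cauchy_kernel_def kernel_diff_empty)

lemma kernel_expansion:
  assumes "(x, y) \<in> kernel_domain M"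
  shows "(\<lambda>n. kernel_term v m kernel_numerator n (x, y)) sums kernel_diff {#} (y - x)"
    and "norm (kernel_term v m kernel_numerator n (x, y)) \<le>
      real ((n + m) choose m) * norm x ^ n / norm y ^ (m + n)"
  using assms kernel_taylor[of "- x" y] subspace_neg[OF subspace_M]
  by (auto simp: kernel_domain_def taylor_term_eq_kernel_term)

subsection \<open>Normal convergence\<close>

lemma continuous_on_kernel_term:
  "continuous_on (kernel_domain M) (kernel_term v m kernel_numerator n)"
proof -
  have 1: "continuous_on (kernel_domain M) (\<lambda>z. fueter_poly v m (\<lambda>s. int (k s)) (fst z))"
    if "k \<in> multi_indices_deg {1..m} n" for k
    by (rule continuous_on_compose2[OF continuous_on_fueter_poly[OF that, of UNIV]])
      (auto intro: continuous_intros)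
  have 2: "continuous_on (kernel_domain M) (\<lambda>z. kernel_numerator k (snd z))" for k
    by (rule continuous_on_compose2[OF continuous_on_kernel_numerator[of UNIV]])
      (auto intro: continuous_intros)
  have 3: "continuous_on (kernel_domain M) (\<lambda>z. 1 / norm (snd z) ^ (m + 2 * n + 1))"
    by (intro continuous_intros) (auto simp: kernel_domain_def)
  show ?thesis
    unfolding kernel_term_def case_prod_unfold
    by (intro continuous_on_sum bounded_bilinear.continuous_on[OF bounded_bilinear_times]
        continuous_on_scaleR 1 2 3)
qed

text \<open>
  On a compact set the ratio \<open>\<bar>x\<bar> / \<bar>y\<bar>\<close> has a maximum \<open>\<rho> < 1\<close> and \<open>\<bar>y\<bar>\<close> a positive minimum, so the terms
  are dominated by multiples of those of the binomial series of \<open>(1 - \<rho>)\<close> to the power \<open>- (m + 1)\<close>.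
\<close>

lemma normally_convergent_kernel_term:
  "normally_convergent_on (kernel_domain M) (kernel_term v m kernel_numerator)"
  unfolding normally_convergent_on_def
proof (intro conjI allI impI continuous_on_kernel_term)
  fix C assume C: "compact C \<and> C \<noteq> {} \<and> C \<subseteq> kernel_domain M"
  let ?f = "kernel_term v m kernel_numerator"
  have nz: "snd z \<noteq> 0" if "z \<in> C" for z
    using C that by (auto simp: kernel_domain_def)
  have "continuous_on C (\<lambda>z. norm (fst z) / norm (snd z))"
    by (intro continuous_intros) (use nz in auto)
  then obtain z1 where z1: "z1 \<in> C"
    "\<And>z. z \<in> C \<Longrightarrow> norm (fst z) / norm (snd z) \<le> norm (fst z1) / norm (snd z1)"
    using continuous_attains_sup[of C "\<lambda>z. norm (fst z) / norm (snd z)"] C by blast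
  have "continuous_on C (\<lambda>z. norm (snd z))"
    by (intro continuous_intros)
  then obtain z2 where z2: "z2 \<in> C" "\<And>z. z \<in> C \<Longrightarrow> norm (snd z2) \<le> norm (snd z)"
    using continuous_attains_inf[of C "\<lambda>z. norm (snd z)"] C by blast
  define \<rho> where "\<rho> = norm (fst z1) / norm (snd z1)"
  define \<delta> where "\<delta> = norm (snd z2)"
  have "norm (fst z1) < norm (snd z1)"
    using z1(1) C by (auto simp: kernel_domain_def)
  then have \<rho>: "0 \<le> \<rho>" "\<rho> < 1"
    using nz[OF z1(1)] by (auto simp: \<rho>_def divide_simps)
  have \<delta>: "0 < \<delta>"
    using nz[OF z2(1)] by (simp add: \<delta>_def)
  let ?b = "\<lambda>n. rising_coeff (real m + 1) n * \<rho> ^ n / \<delta> ^ m"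
  have le: "norm (?f n z) \<le> ?b n" if z: "z \<in> C" for n z
  proof -
    obtain x y where xy: "z = (x, y)"
      by (cases z)
    have y: "y \<noteq> 0"
      using nz[OF z] xy by simp
    have "norm (?f n z) \<le> real ((n + m) choose m) * norm x ^ n / norm y ^ (m + n)"
      using kernel_expansion(2)[of x y n] C z xy by auto
    also have "\<dots> = rising_coeff (real m + 1) n * (norm x / norm y) ^ n / norm y ^ m"
      by (simp add: rising_coeff_Suc_nat power_divide power_add mult.commute)
    also have "\<dots> \<le> ?b n"
      using z1(2)[OF z] z2(2)[OF z] \<rho> \<delta> rising_coeff_nonneg[of "real m + 1" n]
      by (intro frac_le mult_mono power_mono mult_nonneg_nonneg zero_less_power)
        (auto simp: xy \<rho>_def \<delta>_def)
    finally show ?thesis .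
  qed
  have "summable ?b"
  proof -
    have "cmod (of_real \<rho>) < 1"
      using \<rho> by simp
    from sums_Re[OF rising_coeff_sums[OF this, of "real m + 1"]]
    have "summable (\<lambda>n. rising_coeff (real m + 1) n * \<rho> ^ n)"
      by (auto simp: sums_iff simp flip: of_real_power of_real_mult)
    then show ?thesis
      by (rule summable_divide)
  qed
  then show "summable (\<lambda>n. SUP z\<in>C. norm (?f n z))"
  proof (rule summable_comparison_test'[where N = 0])
    fix n
    have bdd: "bdd_above ((\<lambda>z. norm (?f n z)) ` C)"
      using le by (intro bdd_aboveI2)
    have "0 \<le> norm (?f n z1)"
      by simp
    also have "\<dots> \<le> (SUP z\<in>C. norm (?f n z))"
      by (intro cSUP_upper z1 bdd)
    finally have "0 \<le> (SUP z\<in>C. norm (?f n z))" .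
    moreover have "(SUP z\<in>C. norm (?f n z)) \<le> ?b n"
      using C by (intro cSUP_least le) auto
    ultimately show "norm (SUP z\<in>C. norm (?f n z)) \<le> ?b n"
      by simp
  qed
qed

subsection \<open>Real analyticity\<close>

text \<open>
  At a point \<open>(x\<^sub>0, y\<^sub>0)\<close> the kernel is expanded around \<open>y\<^sub>0 - x\<^sub>0\<close> in the increment \<open>h\<close> of \<open>y - x\<close>. Each
  coordinate of \<open>h\<close> is the difference of the increments of a coordinate of \<open>y\<close> and of \<open>x\<close>; so the
  derivative in a direction of \<open>x\<close> is minus that in the same direction of \<open>y\<close>.
\<close>

lemma real_analytic_kernel:
  "real_analytic_in_on ({..m} <+> {..m}) (pair_coord v) (kernel_domain M)
    (\<lambda>(x, y). cauchy_kernel c m (y - x))"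
  unfolding real_analytic_in_on_def
proof (intro ballI)
  fix p assume p: "p \<in> kernel_domain M"
  let ?I = "{..m} <+> {..m} :: (nat + nat) set"
  let ?e = "case_sum (\<lambda>_. - 1) (\<lambda>_. 1) :: nat + nat \<Rightarrow> real"
  let ?\<sigma> = "case_sum (\<lambda>s. s) (\<lambda>s. s) :: nat + nat \<Rightarrow> nat"
  define y where "y = snd p - fst p"
  have y: "y \<in> M" "y \<noteq> 0"
    using p by (auto simp: kernel_domain_def y_def intro!: subspace_diff subspace_M)
  obtain K D where K: "0 \<le> K" "0 < D"
    "\<And>B. set_mset B \<subseteq> {..m} \<Longrightarrow> norm (kernel_diff B y) \<le> K * D ^ size B * fact (size B)"
    using norm_kernel_diff_le[OF y] by blast
  define N where "N = real (card ?I)"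
  have N: "N = 2 * (real m + 1)"
    by (simp add: N_def card_Plus)
  \<comment> \<open>On the cube of radius \<open>r\<close> one has \<open>\<bar>h\<bar> \<le> r N\<close>. The bound \<open>\<bar>y\<bar>\<close> keeps the Taylor series of the
    kernel convergent, the bound \<open>1 / D\<close> makes the multi-index series absolutely summable.\<close>
  define \<mu> where "\<mu> = min (norm y) (1 / D)"
  have \<mu>: "0 < \<mu>" "\<mu> \<le> norm y" "\<mu> \<le> 1 / D"
    using y K(2) by (simp_all add: \<mu>_def)
  define r where "r = \<mu> / (2 * N)"
  have r: "0 < r" "r * N < norm y" "D * r * N < 1"
  proof -
    have "N \<noteq> 0"
      using N by simp
    then have "r * N = \<mu> / 2"
      by (simp add: r_def)
    then have less: "r * N < norm y" "r * N < 1 / D"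
      using \<mu> by simp_all
    then show "r * N < norm y" "D * r * N < 1"
      using K(2) by (simp_all add: field_simps)
    show "0 < r"
      using \<mu>(1) by (simp add: r_def N)
  qed
  define G where "G C = prod_mset (image_mset ?e C) *\<^sub>R kernel_diff (image_mset ?\<sigma> C) y"
    for C :: "(nat + nat) multiset"
  have e1: "\<bar>prod_mset (image_mset ?e C)\<bar> = 1" for C
    by (induction C) (auto simp: abs_mult split: sum.split)
  have bound: "norm (G C) \<le> K * D ^ size C * fact (size C)" if "set_mset C \<subseteq> ?I" for C
  proof -
    have "set_mset (image_mset ?\<sigma> C) \<subseteq> {..m}"
      using that by auto
    from K(3)[OF this] show ?thesis
      by (simp add: G_def e1)
  qed
  have "((\<lambda>\<alpha>. (\<Prod>i\<in>?I. (pair_coord v i z - pair_coord v i p) ^ \<alpha> i) *\<^sub>R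
      ((1 / sphere_const m) *\<^sub>R ((1 / multi_fact ?I \<alpha>) *\<^sub>R G (Abs_multiset \<alpha>)))) has_sum
      (case z of (x, y) \<Rightarrow> cauchy_kernel c m (y - x))) (multi_indices ?I)"
    if z: "z \<in> kernel_domain M" and near: "\<forall>i\<in>?I. \<bar>pair_coord v i z - pair_coord v i p\<bar> < r" for z
  proof -
    define w where "w i = pair_coord v i z - pair_coord v i p" for i
    define h where "h = (snd z - fst z) - y"
    have h: "h \<in> M"
      using z y by (auto simp: kernel_domain_def h_def intro!: subspace_diff subspace_M)
    have coord_h: "coord h s = w (Inr s) - w (Inl s)" for s
      by (simp add: coord_def h_def w_def y_def pair_coord_def inner_diff_left)
    have "norm h \<le> (\<Sum>s\<le>m. \<bar>coord h s\<bar>)"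
    proof -
      have "norm (v s) = 1" if "s \<le> m" for s
        using that by (simp add: norm_eq_sqrt_inner inner_basis)
      then have "norm (\<Sum>s\<le>m. coord h s *\<^sub>R v s) \<le> (\<Sum>s\<le>m. \<bar>coord h s\<bar>)"
        by (intro sum_norm_le) simp
      then show ?thesis
        using expansion[OF h] by (simp add: coord_def)
    qed
    also have "\<dots> \<le> (\<Sum>s\<le>m. 2 * r)"
    proof (rule sum_mono)
      fix s assume "s \<in> {..m}"
      then have "\<bar>w (Inr s)\<bar> < r" "\<bar>w (Inl s)\<bar> < r"
        using near by (auto simp: w_def)
      then show "\<bar>coord h s\<bar> \<le> 2 * r"
        unfolding coord_h by linarith
    qed
    also have "\<dots> = r * N"
      by (simp add: N)
    finally have "norm h < norm y"
      using r by simp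
    from kernel_taylor(1)[OF h y(1) this]
    have "(\<lambda>n. taylor_term n h y) sums kernel_diff {#} (snd z - fst z)"
      by (simp add: h_def)
    moreover have "taylor_term n h y =
        (1 / fact n) *\<^sub>R word_sum ?I (\<lambda>i. of_real (w i)) G n {#}" for n
    proof -
      have "(\<Sum>s\<le>m. coord h s *\<^sub>R H s) = (\<Sum>i\<in>?I. (?e i * w i) *\<^sub>R H (?\<sigma> i))" for H :: "nat \<Rightarrow> 'a"
        by (simp add: sum.Plus coord_h scaleR_left_diff_distrib sum_subtractf sum_negf)
      from word_sum_map[where J = "{..m}" and I = ?I and z = "coord h" and w = w
          and e = ?e and \<sigma> = ?\<sigma> and G = "\<lambda>B. kernel_diff B y" and n = n and C = "{#}", OF this]
      show ?thesis
        by (simp add: taylor_term_def G_def[abs_def])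
    qed
    ultimately have "(\<lambda>n. (1 / fact n) *\<^sub>R word_sum ?I (\<lambda>i. of_real (w i)) G n {#}) sums
        kernel_diff {#} (snd z - fst z)"
      by simp
    then have "((\<lambda>\<alpha>. (\<Prod>i\<in>?I. w i ^ \<alpha> i) *\<^sub>R ((1 / multi_fact ?I \<alpha>) *\<^sub>R G (Abs_multiset \<alpha>)))
        has_sum kernel_diff {#} (snd z - fst z)) (multi_indices ?I)"
      using r K near
      by (intro has_sum_multi_indices[where r = r and D = D and K = K] bound)
        (auto simp: w_def N_def less_imp_le)
    then have "((\<lambda>\<alpha>. (1 / sphere_const m) *\<^sub>R ((\<Prod>i\<in>?I. w i ^ \<alpha> i) *\<^sub>R
        ((1 / multi_fact ?I \<alpha>) *\<^sub>R G (Abs_multiset \<alpha>))))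
        has_sum (1 / sphere_const m) *\<^sub>R kernel_diff {#} (snd z - fst z)) (multi_indices ?I)"
      by (rule has_sum_scaleR)
    moreover have "(1 / sphere_const m) *\<^sub>R kernel_diff {#} (snd z - fst z) =
        (case z of (x, y) \<Rightarrow> cauchy_kernel c m (y - x))"
      using z by (auto simp: kernel_domain_def cauchy_kernel_eq subspace_diff subspace_M)
    ultimately show ?thesis
      by (simp add: w_def mult_ac)
  qed
  with r(1) show "\<exists>r>0. \<exists>a. \<forall>z\<in>kernel_domain M. (\<forall>i\<in>?I. \<bar>pair_coord v i z - pair_coord v i p\<bar> < r) \<longrightarrow>
      ((\<lambda>\<alpha>. (\<Prod>i\<in>?I. (pair_coord v i z - pair_coord v i p) ^ \<alpha> i) *\<^sub>R a \<alpha>) has_sum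
        (case z of (x, y) \<Rightarrow> cauchy_kernel c m (y - x))) (multi_indices ?I)"
    by (intro exI[of _ r] conjI
        exI[of _ "\<lambda>\<alpha>. (1 / sphere_const m) *\<^sub>R ((1 / multi_fact ?I \<alpha>) *\<^sub>R G (Abs_multiset \<alpha>))"]) blast+
qed

end

theorem theorem3p18:
  fixes c :: "'a::{euclidean_space, real_algebra_1} \<Rightarrow> 'a"
    and M :: "'a set"
    and v :: "nat \<Rightarrow> 'a"
    and m d :: nat
  assumes "star_involution c"
    and "imaginary_units c \<noteq> {}"
    and "hypercomplex_subspace c M"
    and "hypercomplex_basis c M m v"
    and "m \<le> d"
    and "ordered_basis v d UNIV"
    and "orthonormal_family v d"
  shows "(\<exists>q :: (nat \<Rightarrow> nat) \<Rightarrow> 'a \<Rightarrow> 'a.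
      (\<forall>n. \<forall>k\<in>multi_indices_deg {1..m} n.
         q k \<in> (M - {0}) \<rightarrow> M \<and>
         homogeneous_polynomial_on v m (n + 1) (M - {0}) (q k)) \<and>
      (\<forall>(x, y)\<in>kernel_domain M.
         summable (\<lambda>n. kernel_term v m q n (x, y)) \<and>
         cauchy_kernel c m (y - x) =
           (1 / sphere_const m) *\<^sub>R (\<Sum>n. kernel_term v m q n (x, y))) \<and>
      (\<forall>n. \<forall>(x, y)\<in>kernel_domain M.
         norm (kernel_term v m q n (x, y)) \<le>
           sqrt 2 * real ((n + m) choose m) * norm x ^ n / norm y ^ (m + n)) \<and>
      normally_convergent_on (kernel_domain M) (kernel_term v m q)) \<and>
    real_analytic_in_on ({..m} <+> {..m}) (pair_coord v) (kernel_domain M)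
      (\<lambda>(x, y). cauchy_kernel c m (y - x))"
proof -
  interpret hypercomplex c M v m
    using assms by unfold_locales (auto simp: orthonormal_family_def)
  let ?t = "kernel_term v m kernel_numerator"
  have sums: "summable (\<lambda>n. ?t n (x, y)) \<and>
      cauchy_kernel c m (y - x) = (1 / sphere_const m) *\<^sub>R (\<Sum>n. ?t n (x, y))"
    if "(x, y) \<in> kernel_domain M" for x y
  proof -
    have "y - x \<in> M"
      using that by (auto simp: kernel_domain_def intro!: subspace_diff subspace_M)
    then show ?thesis
      using kernel_expansion(1)[OF that] by (simp add: sums_iff cauchy_kernel_eq)
  qed
  have bound: "norm (?t n (x, y)) \<le>
      sqrt 2 * real ((n + m) choose m) * norm x ^ n / norm y ^ (m + n)"
    if "(x, y) \<in> kernel_domain M" for n x y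
  proof -
    let ?b = "real ((n + m) choose m) * norm x ^ n / norm y ^ (m + n)"
    have "norm (?t n (x, y)) \<le> 1 * ?b"
      using kernel_expansion(2)[OF that, of n] by simp
    also have "\<dots> \<le> sqrt 2 * ?b"
      by (intro mult_right_mono) auto
    finally show ?thesis
      by (simp add: mult.assoc)
  qed
  have "\<forall>n. \<forall>k\<in>multi_indices_deg {1..m} n. kernel_numerator k \<in> (M - {0}) \<rightarrow> M \<and>
      homogeneous_polynomial_on v m (n + 1) (M - {0}) (kernel_numerator k)"
    by (intro allI ballI conjI Pi_I kernel_numerator_in_M homogeneous_kernel_numerator)
  moreover have "\<forall>(x, y)\<in>kernel_domain M. summable (\<lambda>n. ?t n (x, y)) \<and>
      cauchy_kernel c m (y - x) = (1 / sphere_const m) *\<^sub>R (\<Sum>n. ?t n (x, y))"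
    by (intro ballI; clarify; rule sums)
  moreover have "\<forall>n. \<forall>(x, y)\<in>kernel_domain M. norm (?t n (x, y)) \<le>
      sqrt 2 * real ((n + m) choose m) * norm x ^ n / norm y ^ (m + n)"
    by (intro allI ballI; clarify; rule bound)
  ultimately show ?thesis
    by (intro conjI exI[of _ kernel_numerator] normally_convergent_kernel_term real_analytic_kernel)
qed

end
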